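(* Let $(\alpha|\beta)\in\mathscr P^2(n)$. The signed Young permutation module $M(\alpha|\beta)$ is indecomposable if and only if one of the following holds: (i) $(\alpha|\beta)=((m)|(n'))$ for non-negative integers $m,n'$ with $m+n'=n$ (where $(0)$ means $\varnothing$) such that either (a) $m=0$, (b) $n'=0$, or (c) $p$ divides $m+n'$; (ii) $(\alpha|\beta)$ is $((kp-1,1)|\varnothing)$ or $(\varnothing|(kp-1,1))$ for some $k\in\mathbb N$. In cases (i)(a) and (i)(b), $\mathrm{End}_{F\mathfrak S_n}M(\alpha|\beta)\cong F$; in all remaining cases $\mathrm{End}_{F\mathfrak S_n}M(\alpha|\beta)\cong F[x]/\langle x^2\rangle$.
   Context: $F$ is a field of odd prime characteristic $p$; $\mathfrak S_n$ is the symmetric group on $\{1,\dots,n\}$. $\mathscr P^2(n)$ is the set of pairs $(\alpha|\beta)$ of partitions (possibly empty, $\varnothing$) with $|\alpha|+|\beta|=n$. $M(\alpha|\beta)=\mathrm{Ind}_{\mathfrak S_\alpha\times\mathfrak S_\beta}^{\mathfrak S_n}(F\boxtimes\mathrm{sgn})$, where $\mathfrak S_\alpha=\mathfrak S_{\alpha_1}\times\mathfrak S_{\alpha_2}\times\cdots$ is the Young subgroup permuting $\{1,\dots,|\alpha|\}$ (in consecutive blocks) acting trivially, and $\mathfrak S_\beta$ is the Young subgroup of $\{|\alpha|+1,\dots,n\}$ acting by the sign character. *)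

theory Defs
  imports "HOL-Combinatorics.Permutations" "HOL-Library.Function_Algebras" "HOL-Computational_Algebra.Polynomial"
begin

type_synonym perm = "nat \<Rightarrow> nat"

definition is_partition :: "nat list \<Rightarrow> bool" where
  "is_partition \<alpha> \<longleftrightarrow> sorted_wrt (\<ge>) \<alpha> \<and> (\<forall>x\<in>set \<alpha>. 0 < x)"

definition P2 :: "nat \<Rightarrow> (nat list \<times> nat list) set" where
  "P2 n = {(\<alpha>, \<beta>). is_partition \<alpha> \<and> is_partition \<beta> \<and> sum_list \<alpha> + sum_list \<beta> = n}"

text \<open>The symmetric group on {1..n}; the product g h is composition g o h.\<close>
definition Sym :: "nat \<Rightarrow> perm set" where
  "Sym n = {\<sigma>. \<sigma> permutes {1..n}}"

definition block :: "nat list \<Rightarrow> nat \<Rightarrow> nat set" where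
  "block c j = {sum_list (take j c) <.. sum_list (take (Suc j) c)}"

text \<open>Young subgroup S_alpha x S_beta of S_n: the blocks of alpha occupy {1..|alpha|}
  consecutively, those of beta occupy {|alpha|+1..n} consecutively.\<close>
definition young :: "nat list \<Rightarrow> nat list \<Rightarrow> nat \<Rightarrow> perm set" where
  "young \<alpha> \<beta> n = {\<sigma> \<in> Sym n. \<forall>j < length (\<alpha> @ \<beta>). \<sigma> ` block (\<alpha> @ \<beta>) j = block (\<alpha> @ \<beta>) j}"

text \<open>The character F boxtimes sgn of the Young subgroup: trivial on S_alpha,
  sign on S_beta (the sign of the restriction of h to {|alpha|+1..n}).\<close>
definition chi :: "nat list \<Rightarrow> perm \<Rightarrow> 'a::field" where
  "chi \<alpha> h = of_int (sign (\<lambda>i. if sum_list \<alpha> < i then h i else i))"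

text \<open>Model of the induced module Ind_H^G(chi): functions f on S_n with
  f (h o s) = chi h * f s for h in H (vanishing outside S_n), with G acting by
  (g . f) s = f (s o g).\<close>
definition Mmod :: "nat list \<Rightarrow> nat list \<Rightarrow> nat \<Rightarrow> (perm \<Rightarrow> 'a::field) set" where
  "Mmod \<alpha> \<beta> n = {f. (\<forall>\<sigma>. \<sigma> \<notin> Sym n \<longrightarrow> f \<sigma> = 0) \<and>
      (\<forall>h \<in> young \<alpha> \<beta> n. \<forall>\<sigma> \<in> Sym n. f (h \<circ> \<sigma>) = chi \<alpha> h * f \<sigma>)}"

definition act :: "perm \<Rightarrow> (perm \<Rightarrow> 'a) \<Rightarrow> (perm \<Rightarrow> 'a)" where
  "act g f = (\<lambda>\<sigma>. f (\<sigma> \<circ> g))"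

definition submodule :: "nat \<Rightarrow> (perm \<Rightarrow> 'a::field) set \<Rightarrow> (perm \<Rightarrow> 'a) set \<Rightarrow> bool" where
  "submodule n M U \<longleftrightarrow> U \<subseteq> M \<and> 0 \<in> U \<and> (\<forall>f\<in>U. \<forall>g\<in>U. f + g \<in> U) \<and>
     (\<forall>c. \<forall>f\<in>U. (\<lambda>\<sigma>. c * f \<sigma>) \<in> U) \<and> (\<forall>g \<in> Sym n. \<forall>f\<in>U. act g f \<in> U)"

definition indecomposable :: "nat \<Rightarrow> (perm \<Rightarrow> 'a::field) set \<Rightarrow> bool" where
  "indecomposable n M \<longleftrightarrow> M \<noteq> {0} \<and>
     (\<forall>U W. submodule n M U \<and> submodule n M W \<and> U \<inter> W = {0} \<and>
        {u + w | u w. u \<in> U \<and> w \<in> W} = M \<longrightarrow> U = {0} \<or> W = {0})"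

definition Endo :: "nat \<Rightarrow> (perm \<Rightarrow> 'a::field) set \<Rightarrow> ((perm \<Rightarrow> 'a) \<Rightarrow> (perm \<Rightarrow> 'a)) set" where
  "Endo n M = {\<phi>. (\<forall>f\<in>M. \<phi> f \<in> M) \<and> (\<forall>f. f \<notin> M \<longrightarrow> \<phi> f = 0) \<and>
     (\<forall>f\<in>M. \<forall>g\<in>M. \<phi> (f + g) = \<phi> f + \<phi> g) \<and>
     (\<forall>c. \<forall>f\<in>M. \<phi> (\<lambda>\<sigma>. c * f \<sigma>) = (\<lambda>\<sigma>. c * \<phi> f \<sigma>)) \<and>
     (\<forall>g\<in>Sym n. \<forall>f\<in>M. \<phi> (act g f) = act g (\<phi> f))}"

definition idM :: "(perm \<Rightarrow> 'a::field) set \<Rightarrow> (perm \<Rightarrow> 'a) \<Rightarrow> (perm \<Rightarrow> 'a)" where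
  "idM M = (\<lambda>f. if f \<in> M then f else 0)"

definition smultE :: "'a::field \<Rightarrow> ((perm \<Rightarrow> 'a) \<Rightarrow> (perm \<Rightarrow> 'a)) \<Rightarrow> ((perm \<Rightarrow> 'a) \<Rightarrow> (perm \<Rightarrow> 'a))" where
  "smultE c \<phi> = (\<lambda>f \<sigma>. c * \<phi> f \<sigma>)"

definition End_iso_F :: "nat \<Rightarrow> (perm \<Rightarrow> 'a::field) set \<Rightarrow> bool" where
  "End_iso_F n M \<longleftrightarrow> (\<exists>\<Phi> :: ((perm \<Rightarrow> 'a) \<Rightarrow> (perm \<Rightarrow> 'a)) \<Rightarrow> 'a.
     bij_betw \<Phi> (Endo n M) UNIV \<and>
     (\<forall>\<phi>\<in>Endo n M. \<forall>\<psi>\<in>Endo n M. \<Phi> (\<phi> + \<psi>) = \<Phi> \<phi> + \<Phi> \<psi> \<and> \<Phi> (\<phi> \<circ> \<psi>) = \<Phi> \<phi> * \<Phi> \<psi>) \<and>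
     (\<forall>c. \<forall>\<phi>\<in>Endo n M. \<Phi> (smultE c \<phi>) = c * \<Phi> \<phi>) \<and>
     \<Phi> (idM M) = 1)"

text \<open>F[x]/<x^2>, realised on canonical representatives {p. degree p \<le> 1}
  with multiplication (p * q) mod x^2.\<close>
definition dual_numbers :: "'a::field poly set" where
  "dual_numbers = {p. degree p \<le> 1}"

definition End_iso_dual :: "nat \<Rightarrow> (perm \<Rightarrow> 'a::field) set \<Rightarrow> bool" where
  "End_iso_dual n M \<longleftrightarrow> (\<exists>\<Phi> :: ((perm \<Rightarrow> 'a) \<Rightarrow> (perm \<Rightarrow> 'a)) \<Rightarrow> 'a poly.
     bij_betw \<Phi> (Endo n M) dual_numbers \<and>
     (\<forall>\<phi>\<in>Endo n M. \<forall>\<psi>\<in>Endo n M. \<Phi> (\<phi> + \<psi>) = \<Phi> \<phi> + \<Phi> \<psi> \<and>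
         \<Phi> (\<phi> \<circ> \<psi>) = (\<Phi> \<phi> * \<Phi> \<psi>) mod [:0, 0, 1:]) \<and>
     (\<forall>c. \<forall>\<phi>\<in>Endo n M. \<Phi> (smultE c \<phi>) = smult c (\<Phi> \<phi>)) \<and>
     \<Phi> (idM M) = 1)"

definition row :: "nat \<Rightarrow> nat list" where
  "row m = (if m = 0 then [] else [m])"

end

theory Submission
  imports Defs
begin

text \<open>
  For two blocks \<open>A\<close>, \<open>B\<close> of the Young subgroup let \<open>T\<close> be left translation by the sum of the
  transpositions \<open>(x y)\<close> with \<open>x \<in> A\<close>, \<open>y \<in> B\<close>; it is an endomorphism of the induced module.
  Write \<open>a = |A|\<close>, \<open>b = |B|\<close>, and let \<open>e\<close> be the value of the character on transpositions of \<open>A\<close>.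

  If \<open>T\<close> has two distinct eigenvalues in the prime field, then the module decomposes, by Fitting's
  lemma. For blocks of the same type, \<open>T\<close> has the eigenvalues \<open>e ab\<close>, \<open>e (ab - a - b)\<close> and, if
  \<open>a, b \<ge> 2\<close>, also \<open>e (ab - 2a - 2b + 2)\<close>. For blocks of opposite type, \<open>(T - e a)(T + e b) = 0\<close> and
  neither factor vanishes. So in an indecomposable module \<open>p\<close> divides the sum of any two parts, and
  one of two parts of the same type is \<open>1\<close>. Three parts would all be divisible by \<open>p\<close> and two
  of them would have the same type, which is absurd.

  Conversely, for two blocks of opposite type, or with \<open>b = 1\<close>, the double cosets of the identity
  and of one swap are the only ones which contribute endomorphisms, so the endomorphism ring is
  spanned by \<open>1\<close> and \<open>T\<close>, and \<open>(T - e a)\<^sup>2 = 0\<close> when \<open>p\<close> divides \<open>a + b\<close>.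
\<close>

section \<open>The symmetric group as a set of functions closed under composition and
  inverses\<close>

lemma Sym_comp: "g \<in> Sym n \<Longrightarrow> h \<in> Sym n \<Longrightarrow> g \<circ> h \<in> Sym n"
  unfolding Sym_def by (auto intro: permutes_compose)

lemma Sym_id: "id \<in> Sym n"
  unfolding Sym_def by (auto simp: permutes_id)

lemma Sym_inv: "g \<in> Sym n \<Longrightarrow> inv g \<in> Sym n"
  unfolding Sym_def by (auto intro: permutes_inv)

lemma Sym_inv_o: "g \<in> Sym n \<Longrightarrow> inv g \<circ> g = id" "g \<in> Sym n \<Longrightarrow> g \<circ> inv g = id"
  unfolding Sym_def by (auto simp: permutes_inv_o)

lemma Sym_comp_left_iff:
  assumes g: "g \<in> Sym n"
  shows "g \<circ> s \<in> Sym n \<longleftrightarrow> s \<in> Sym n"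
proof
  assume "g \<circ> s \<in> Sym n"
  then have "inv g \<circ> (g \<circ> s) \<in> Sym n"
    by (rule Sym_comp[OF Sym_inv[OF g]])
  then show "s \<in> Sym n" by (simp add: comp_assoc[symmetric] Sym_inv_o[OF g])
qed (rule Sym_comp[OF g])

lemma Sym_comp_right_iff:
  assumes g: "g \<in> Sym n"
  shows "s \<circ> g \<in> Sym n \<longleftrightarrow> s \<in> Sym n"
proof
  assume "s \<circ> g \<in> Sym n"
  then have "s \<circ> g \<circ> inv g \<in> Sym n"
    by (rule Sym_comp[OF _ Sym_inv[OF g]])
  then show "s \<in> Sym n" by (simp add: comp_assoc Sym_inv_o[OF g])
qed (rule Sym_comp[OF _ g])

lemma finite_Sym: "finite (Sym n)"
  unfolding Sym_def by (rule finite_permutations) simp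

lemma Sym_inj: "g \<in> Sym n \<Longrightarrow> inj g"
  unfolding Sym_def by (auto intro: permutes_inj)

lemma Sym_eq_iff: "g \<in> Sym n \<Longrightarrow> g x = g y \<longleftrightarrow> x = y"
  by (simp add: inj_eq Sym_inj)

lemma transpose_in_Sym: "x \<in> {1..n} \<Longrightarrow> y \<in> {1..n} \<Longrightarrow> transpose x y \<in> Sym n"
  unfolding Sym_def by (auto intro: permutes_swap_id)

section \<open>Consecutive blocks of a composition\<close>

lemma sum_take_mono:
  assumes "i \<le> j"
  shows "sum_list (take i c) \<le> sum_list (take j (c :: nat list))"
proof -
  obtain d where "j = i + d" using assms le_Suc_ex by blast
  then show ?thesis by (simp add: take_add)
qed

lemma block_subset: "block c j \<subseteq> {1..sum_list c}"
proof -
  have "sum_list (take (Suc j) c) \<le> sum_list (take (max (Suc j) (length c)) c)"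
    by (rule sum_take_mono) simp
  then show ?thesis unfolding block_def by auto
qed

lemma block_disjoint: "i \<noteq> j \<Longrightarrow> block c i \<inter> block c j = {}"
proof (induction i j rule: linorder_wlog)
  case (le i j)
  then have "sum_list (take (Suc i) c) \<le> sum_list (take j c)" by (intro sum_take_mono) simp
  then show ?case unfolding block_def by auto
qed auto

lemma card_block: "j < length c \<Longrightarrow> card (block c j) = c ! j"
  unfolding block_def by (simp add: take_Suc_conv_app_nth)

lemma ex_block:
  assumes "x \<in> {1..sum_list c}"
  obtains j where "j < length c" "x \<in> block c j"
proof -
  \<comment> \<open>The block of \<open>x\<close> is the first one whose right end reaches
    \<open>x\<close>; minimality puts \<open>x\<close> beyond its left end.\<close>
  define j where "j = (LEAST j. x \<le> sum_list (take (Suc j) c))"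
  have ne: "c \<noteq> []" using assms by auto
  have ex: "x \<le> sum_list (take (Suc (length c - 1)) c)" using assms ne by simp
  have 1: "x \<le> sum_list (take (Suc j) c)" unfolding j_def by (rule LeastI, rule ex)
  have "j \<le> length c - 1" unfolding j_def by (rule Least_le, rule ex)
  then have "j < length c" using ne by (cases c) auto
  moreover have "sum_list (take j c) < x"
  proof (cases j)
    case 0
    then show ?thesis using assms by simp
  next
    case (Suc i)
    then have "\<not> x \<le> sum_list (take (Suc i) c)"
      using not_less_Least[of i "\<lambda>j. x \<le> sum_list (take (Suc j) c)"] by (simp add: j_def)
    then show ?thesis using Suc by simp
  qed
  ultimately show thesis using that 1 unfolding block_def by auto
qed

section \<open>The Young subgroup and its sign character\<close>

text \<open>The character \<open>chi \<alpha>\<close> is still multiplicative on this subgroup, although it is larger than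
  the Young subgroup.\<close>
definition side_stab :: "nat list \<Rightarrow> nat \<Rightarrow> perm set" where
  "side_stab \<alpha> n = {h \<in> Sym n. \<forall>i. sum_list \<alpha> < h i \<longleftrightarrow> sum_list \<alpha> < i}"

text \<open>The cut at \<open>sum_list \<alpha>\<close> is the right end of the first
  \<open>length \<alpha>\<close> blocks, so no block straddles it.\<close>

lemma block_above_iff:
  assumes "x \<in> block (\<alpha> @ \<beta>) j"
  shows "sum_list \<alpha> < x \<longleftrightarrow> length \<alpha> \<le> j"
proof
  assume "length \<alpha> \<le> j"
  then have "sum_list (take (length \<alpha>) (\<alpha> @ \<beta>)) \<le> sum_list (take j (\<alpha> @ \<beta>))"
    by (rule sum_take_mono)
  then show "sum_list \<alpha> < x" using assms by (simp add: block_def)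
next
  assume a: "sum_list \<alpha> < x"
  show "length \<alpha> \<le> j"
  proof (rule ccontr)
    assume "\<not> length \<alpha> \<le> j"
    then have "sum_list (take (Suc j) (\<alpha> @ \<beta>)) \<le> sum_list (take (length \<alpha>) (\<alpha> @ \<beta>))"
      by (intro sum_take_mono) simp
    then show False using assms a by (simp add: block_def)
  qed
qed

lemma young_subset_Sym: "young \<alpha> \<beta> n \<subseteq> Sym n"
  unfolding young_def by auto

lemma young_block: "h \<in> young \<alpha> \<beta> n \<Longrightarrow> j < length (\<alpha> @ \<beta>) \<Longrightarrow> h ` block (\<alpha> @ \<beta>) j = block (\<alpha> @ \<beta>) j"
  unfolding young_def by auto

lemma young_comp: "g \<in> young \<alpha> \<beta> n \<Longrightarrow> h \<in> young \<alpha> \<beta> n \<Longrightarrow> g \<circ> h \<in> young \<alpha> \<beta> n"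
  unfolding young_def mem_Collect_eq image_comp[symmetric] using Sym_comp by simp

lemma young_id: "id \<in> young \<alpha> \<beta> n"
  unfolding young_def by (auto simp: Sym_id)

lemma image_inv_eq: "inj h \<Longrightarrow> h ` S = S \<Longrightarrow> inv h ` S = S"
  using image_inv_f_f[of h S] by simp

lemma young_inv: "h \<in> young \<alpha> \<beta> n \<Longrightarrow> inv h \<in> young \<alpha> \<beta> n"
  using image_inv_eq[of h] Sym_inj[of h n] by (simp add: young_def Sym_inv)

lemma young_comp_left_iff:
  assumes g: "g \<in> young \<alpha> \<beta> n"
  shows "g \<circ> s \<in> young \<alpha> \<beta> n \<longleftrightarrow> s \<in> young \<alpha> \<beta> n"
proof
  assume "g \<circ> s \<in> young \<alpha> \<beta> n"
  then have "inv g \<circ> (g \<circ> s) \<in> young \<alpha> \<beta> n"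
    by (rule young_comp[OF young_inv[OF g]])
  then show "s \<in> young \<alpha> \<beta> n" by (simp add: comp_assoc[symmetric] Sym_inv_o[OF subsetD[OF young_subset_Sym g]])
qed (rule young_comp[OF g])

lemma young_comp_right_iff:
  assumes g: "g \<in> young \<alpha> \<beta> n"
  shows "s \<circ> g \<in> young \<alpha> \<beta> n \<longleftrightarrow> s \<in> young \<alpha> \<beta> n"
proof
  assume "s \<circ> g \<in> young \<alpha> \<beta> n"
  then have "s \<circ> g \<circ> inv g \<in> young \<alpha> \<beta> n"
    by (rule young_comp[OF _ young_inv[OF g]])
  then show "s \<in> young \<alpha> \<beta> n" by (simp add: comp_assoc Sym_inv_o[OF subsetD[OF young_subset_Sym g]])
qed (rule young_comp[OF _ g])

text \<open>Every point of \<open>{1..n}\<close> lies in a block, which is preserved and lies on one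
  side of the cut; all other points are fixed.\<close>

lemma young_subset_side_stab:
  assumes "sum_list \<alpha> + sum_list \<beta> = n"
  shows "young \<alpha> \<beta> n \<subseteq> side_stab \<alpha> n"
proof
  fix h assume h: "h \<in> young \<alpha> \<beta> n"
  then have hS: "h permutes {1..n}" unfolding young_def Sym_def by auto
  have "sum_list \<alpha> < h i \<longleftrightarrow> sum_list \<alpha> < i" for i
  proof (cases "i \<in> {1..n}")
    case True
    then have "i \<in> {1..sum_list (\<alpha> @ \<beta>)}" using assms by simp
    then obtain j where j: "j < length (\<alpha> @ \<beta>)" "i \<in> block (\<alpha> @ \<beta>) j"
      by (rule ex_block)
    then have "h i \<in> block (\<alpha> @ \<beta>) j" using young_block[OF h j(1)] by blast
    then show ?thesis using block_above_iff j(2) by blast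
  next
    case False
    then show ?thesis using permutes_not_in[OF hS False] by simp
  qed
  then show "h \<in> side_stab \<alpha> n" using hS unfolding side_stab_def Sym_def by auto
qed

lemma side_stab_comp: "g \<in> side_stab \<alpha> n \<Longrightarrow> h \<in> side_stab \<alpha> n \<Longrightarrow> g \<circ> h \<in> side_stab \<alpha> n"
  unfolding side_stab_def by (auto simp: Sym_comp)

text \<open>Prepares the multiplicativity of \<open>sign\<close>, which concerns permutations. The
  truncated map is injective because \<open>h\<close> carries no point across the cut.\<close>

lemma permutation_side_restriction:
  assumes "h \<in> side_stab \<alpha> n"
  shows "permutation (\<lambda>i. if sum_list \<alpha> < i then h i else i)" (is "permutation ?r")
proof -
  have h: "h permutes {1..n}" and s: "\<And>i. sum_list \<alpha> < h i \<longleftrightarrow> sum_list \<alpha> < i"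
    using assms unfolding side_stab_def Sym_def by auto
  have "?r permutes {1..n}"
  proof (rule inj_imp_permutes)
    show "inj_on ?r {1..n}"
    proof (rule inj_onI)
      fix x y assume eq: "?r x = ?r y"
      show "x = y"
      proof (cases "sum_list \<alpha> < x \<longleftrightarrow> sum_list \<alpha> < y")
        case True
        then show ?thesis using eq permutes_inj[OF h] by (auto dest: injD split: if_splits)
      next
        case False
        then show ?thesis using eq s[of x] s[of y] by (auto split: if_splits)
      qed
    qed
    show "?r x \<in> {1..n}" if "x \<in> {1..n}" for x
      using permutes_in_image[OF h, of x] that by simp
    show "?r i = i" if "i \<notin> {1..n}" for i
      using permutes_not_in[OF h that] by simp
  qed simp
  then show ?thesis by (auto simp: permutation_permutes)
qed

text \<open>Truncation above the cut is compatible with composition, as both factors keep every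
  point on its side.\<close>

lemma chi_comp:
  assumes "g \<in> side_stab \<alpha> n" "h \<in> side_stab \<alpha> n"
  shows "(chi \<alpha> (g \<circ> h) :: 'a :: field) = chi \<alpha> g * chi \<alpha> h"
proof -
  have "(\<lambda>i. if sum_list \<alpha> < i then (g \<circ> h) i else i)
      = (\<lambda>i. if sum_list \<alpha> < i then g i else i) \<circ> (\<lambda>i. if sum_list \<alpha> < i then h i else i)"
    using assms unfolding side_stab_def by (auto simp: fun_eq_iff)
  then show ?thesis
    unfolding chi_def
    by (simp add: sign_compose permutation_side_restriction[OF assms(1)]
        permutation_side_restriction[OF assms(2)])
qed

lemma chi_id: "(chi \<alpha> id :: 'a :: field) = 1"
proof -
  have "(\<lambda>i. if sum_list \<alpha> < i then id i else i) = (id :: nat \<Rightarrow> nat)" by auto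
  then show ?thesis unfolding chi_def by (simp add: sign_id)
qed

lemma chi_square: "(chi \<alpha> h :: 'a :: field) * chi \<alpha> h = 1"
  unfolding chi_def by (simp add: sign_def)

lemma chi_transpose:
  assumes "sum_list \<alpha> < x \<longleftrightarrow> sum_list \<alpha> < y" "x \<noteq> y"
  shows "(chi \<alpha> (transpose x y) :: 'a :: field) = (if sum_list \<alpha> < x then -1 else 1)"
proof -
  have "(\<lambda>i. if sum_list \<alpha> < i then transpose x y i else i)
     = (if sum_list \<alpha> < x then transpose x y else id)"
    using assms by (auto simp: fun_eq_iff transpose_def)
  then show ?thesis unfolding chi_def using assms by (simp add: sign_swap_id sign_id)
qed

lemma transpose_in_side_stab:
  assumes "sum_list \<alpha> < x \<longleftrightarrow> sum_list \<alpha> < y" "x \<in> {1..n}" "y \<in> {1..n}"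
  shows "transpose x y \<in> side_stab \<alpha> n"
  using assms transpose_in_Sym[of x n y] unfolding side_stab_def by (auto simp: transpose_def)

lemma transpose_in_young:
  assumes "sum_list \<alpha> + sum_list \<beta> = n" "x \<in> block (\<alpha> @ \<beta>) j" "y \<in> block (\<alpha> @ \<beta>) j"
  shows "transpose x y \<in> young \<alpha> \<beta> n"
proof -
  have "x \<in> {1..n}" "y \<in> {1..n}"
    using assms block_subset[of "\<alpha> @ \<beta>" j] by auto
  moreover have "transpose x y ` block (\<alpha> @ \<beta>) i = block (\<alpha> @ \<beta>) i" for i
    using block_disjoint[of i j "\<alpha> @ \<beta>"] assms(2,3)
    by (intro transpose_image_eq) (cases "i = j"; blast)
  ultimately show ?thesis unfolding young_def by (auto simp: transpose_in_Sym)
qed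

section \<open>Idempotent powers of integral combinations of left translations\<close>

lemma finite_range_of_int:
  assumes "CHAR('a :: ring_1) > 0"
  shows "finite (range (of_int :: int \<Rightarrow> 'a))"
proof -
  let ?p = "int CHAR('a)"
  \<comment> \<open>Reduction modulo the characteristic leaves finitely many residues.\<close>
  have "(of_int i :: 'a) = of_int (i mod ?p)" for i
  proof -
    have "(of_int i :: 'a) = of_int (?p * (i div ?p) + i mod ?p)" by simp
    also have "\<dots> = of_int (i mod ?p)"
      unfolding of_int_add of_int_mult of_int_of_nat_eq of_nat_CHAR by simp
    finally show ?thesis .
  qed
  then have "range (of_int :: int \<Rightarrow> 'a) \<subseteq> of_int ` {0..<?p}"
    using assms by (auto intro!: image_eqI[of _ of_int "_ mod ?p"])
  then show ?thesis by (rule finite_subset) simp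
qed

text \<open>Two powers coincide, so from some exponent \<open>i\<close> on the powers are periodic
  with period \<open>d\<close>. A multiple of \<open>d\<close> that is at least \<open>i\<close>
  then gives an idempotent.\<close>

lemma idempotent_power:
  assumes "finite (range (\<lambda>k. f ^^ k))"
  obtains N where "0 < N" "f ^^ N \<circ> f ^^ N = f ^^ N"
proof -
  have "\<not> inj (\<lambda>k. f ^^ k)" using assms finite_imageD infinite_UNIV_nat by blast
  then obtain i j where ij: "i < j" "f ^^ i = f ^^ j"
    by (metis injI linorder_neqE_nat)
  define d where "d = j - i"
  have d: "0 < d" "f ^^ i = f ^^ (i + d)" using ij by (auto simp: d_def)
  have step: "f ^^ m = f ^^ (m + d)" if "i \<le> m" for m
  proof -
    have "f ^^ (m - i) \<circ> f ^^ i = f ^^ (m - i) \<circ> f ^^ (i + d)" using d(2) by simp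
    then show ?thesis using that by (simp flip: funpow_add)
  qed
  have per: "f ^^ m = f ^^ (m + k * d)" if "i \<le> m" for m k
  proof (induction k)
    case (Suc k)
    then show ?case using step[of "m + k * d"] that by (simp add: algebra_simps)
  qed simp
  \<comment> \<open>The factor \<open>Suc i\<close> keeps the exponent positive even for
    \<open>i = 0\<close>.\<close>
  have "i \<le> Suc i * d" using d(1) by (cases d) auto
  then have "f ^^ (Suc i * d) = f ^^ (Suc i * d + Suc i * d)" by (rule per)
  then show thesis using that[of "Suc i * d"] d(1) by (simp add: funpow_add)
qed

text \<open>Every power of an integral combination of left translations is again one. Over a field of
  positive characteristic the coefficients lie in the finite prime field, so there are only
  finitely many powers.\<close>
lemma finite_powers_left_translations:
  fixes X :: "(perm \<Rightarrow> 'a :: field) \<Rightarrow> perm \<Rightarrow> 'a" and l :: int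
  assumes char: "CHAR('a) > 0" and fin: "finite I"
    and t: "\<And>i. i \<in> I \<Longrightarrow> t i \<in> Sym n"
    and X: "\<And>f s. X f s = (\<Sum>i\<in>I. f (t i \<circ> s)) - of_int l * f s"
  shows "finite (range (\<lambda>k. X ^^ k))"
proof -
  define Z where "Z = range (of_int :: int \<Rightarrow> 'a)"
  \<comment> \<open>\<open>L c\<close> is left translation by the element of the group algebra with
    coefficients \<open>c\<close>.\<close>
  define L where "L c f s = (\<Sum>g\<in>Sym n. c g * f (g \<circ> s))" for c :: "perm \<Rightarrow> 'a" and f and s :: perm
  have Zsum: "(\<Sum>i\<in>J. u i) \<in> Z" if "\<And>i. i \<in> J \<Longrightarrow> u i \<in> Z" for J :: "'i set" and u
  proof -
    have "\<forall>i\<in>J. \<exists>k. u i = of_int k" using that unfolding Z_def by auto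
    then obtain k where "\<forall>i\<in>J. u i = of_int (k i)" by metis
    then have "(\<Sum>i\<in>J. u i) = of_int (\<Sum>i\<in>J. k i)" by simp
    then show ?thesis unfolding Z_def by blast
  qed
  have Zdiff: "a - of_int l * b \<in> Z" if ab: "a \<in> Z" "b \<in> Z" for a b
  proof -
    obtain i j where "a = of_int i" "b = of_int j" using ab unfolding Z_def by (blast elim: rangeE)
    then have "a - of_int l * b = of_int (i - l * j)" by simp
    then show ?thesis unfolding Z_def by blast
  qed
  have "\<exists>c \<in> Sym n \<rightarrow>\<^sub>E Z. X ^^ k = L c" for k
  proof (induction k)
    case 0
    \<comment> \<open>\<open>restrict\<close> makes the coefficients extensional, so that they range
      over a finite function space.\<close>
    let ?c = "restrict (\<lambda>g. if g = id then 1 else 0) (Sym n)"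
    have "L ?c f s = f s" for f s
      unfolding L_def using finite_Sym Sym_id by (simp add: if_distrib[of "\<lambda>x. x * _"] cong: if_cong)
    then have "X ^^ 0 = L ?c" by (auto simp: fun_eq_iff)
    moreover have "1 \<in> Z" "0 \<in> Z" unfolding Z_def by (metis of_int_1 of_int_0 rangeI)+
    then have "?c \<in> Sym n \<rightarrow>\<^sub>E Z" by auto
    ultimately show ?case by blast
  next
    case (Suc k)
    then obtain c where c: "c \<in> Sym n \<rightarrow>\<^sub>E Z" "X ^^ k = L c" by blast
    \<comment> \<open>Substituting \<open>g \<circ> inv (t i)\<close> for \<open>g\<close> absorbs
      the translation by \<open>t i\<close> into the coefficients.\<close>
    let ?c = "restrict (\<lambda>g. (\<Sum>i\<in>I. c (g \<circ> inv (t i))) - of_int l * c g) (Sym n)"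
    have reindex: "(\<Sum>g\<in>Sym n. c g * f (g \<circ> (t i \<circ> s)))
        = (\<Sum>g\<in>Sym n. c (g \<circ> inv (t i)) * f (g \<circ> s))" if "i \<in> I" for i f s
      by (rule sum.reindex_bij_witness[of _ "\<lambda>g. g \<circ> inv (t i)" "\<lambda>g. g \<circ> t i"])
        (use t[OF that] in \<open>simp_all add: comp_assoc Sym_inv_o Sym_comp Sym_inv\<close>)
    have "X (L c f) s = L ?c f s" for f s
    proof -
      have "X (L c f) s = (\<Sum>i\<in>I. \<Sum>g\<in>Sym n. c (g \<circ> inv (t i)) * f (g \<circ> s))
          - of_int l * (\<Sum>g\<in>Sym n. c g * f (g \<circ> s))"
        unfolding X L_def by (simp add: reindex)
      also have "\<dots> = (\<Sum>g\<in>Sym n. \<Sum>i\<in>I. c (g \<circ> inv (t i)) * f (g \<circ> s))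
          - of_int l * (\<Sum>g\<in>Sym n. c g * f (g \<circ> s))"
        by (subst sum.swap) simp
      also have "\<dots> = L ?c f s"
        unfolding L_def
        by (simp add: sum_distrib_left sum_distrib_right sum_subtractf left_diff_distrib mult.assoc)
      finally show ?thesis .
    qed
    then have "X (L c f) = L ?c f" for f by blast
    then have "X ^^ Suc k = L ?c" using c(2) by (simp add: comp_def)
    moreover have "?c \<in> Sym n \<rightarrow>\<^sub>E Z"
      using c(1) t by (auto intro!: Zdiff Zsum simp: Sym_comp Sym_inv PiE_mem)
    ultimately show ?case by blast
  qed
  then have "range (\<lambda>k. X ^^ k) \<subseteq> L ` (Sym n \<rightarrow>\<^sub>E Z)" by blast
  moreover have "finite (Sym n \<rightarrow>\<^sub>E Z)"
    unfolding Z_def by (intro finite_PiE finite_Sym finite_range_of_int char)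
  ultimately show ?thesis using finite_subset by blast
qed

section \<open>Direct sum decompositions and idempotent endomorphisms\<close>

lemma submodule_minus:
  assumes "submodule n M U" "f \<in> U" "g \<in> U"
  shows "f - g \<in> U"
proof -
  have "(\<lambda>s. - 1 * g s) \<in> U" "\<And>h. h \<in> U \<Longrightarrow> f + h \<in> U" using assms unfolding submodule_def by blast+
  then have "f + (\<lambda>s. - 1 * g s) \<in> U" by blast
  also have "f + (\<lambda>s. - 1 * g s) = f - g" by (auto simp: fun_eq_iff)
  finally show ?thesis .
qed

text \<open>The projection onto \<open>U\<close> along \<open>W\<close> is an idempotent
  endomorphism. If it is 0 then \<open>U\<close> vanishes, and if it is the identity then
  \<open>W\<close> does.\<close>

lemma indecomposable_if_trivial_idempotents:
  assumes "M \<noteq> {0}"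
    and idem: "\<And>E. E \<in> Endo n M \<Longrightarrow> E \<circ> E = E \<Longrightarrow> E = 0 \<or> E = idM M"
  shows "indecomposable n M"
  unfolding indecomposable_def
proof (intro conjI allI impI)
  fix U W
  assume "submodule n M U \<and> submodule n M W \<and> U \<inter> W = {0} \<and>
        {u + w | u w. u \<in> U \<and> w \<in> W} = M"
  then have U: "submodule n M U" and W: "submodule n M W" and UW: "U \<inter> W = {0}"
    and sum: "{u + w | u w. u \<in> U \<and> w \<in> W} = M" by auto
  have U0: "0 \<in> U" and W0: "0 \<in> W" and UM: "U \<subseteq> M" and WM: "W \<subseteq> M"
    using U W unfolding submodule_def by auto
  \<comment> \<open>On \<open>M\<close> the component in \<open>U\<close> is unique because
    \<open>U\<close> and \<open>W\<close> meet in 0; outside \<open>M\<close> the value is 0, as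
    membership in \<open>Endo n M\<close> demands.\<close>
  define E where "E f = (if f \<in> M then (THE u. u \<in> U \<and> f - u \<in> W) else 0)" for f
  have E_eq: "E f = u" if "u \<in> U" "f - u \<in> W" for f u
  proof -
    have "f = u + (f - u)" by simp
    then have "f \<in> M" using sum that by blast
    have "v = u" if v: "v \<in> U \<and> f - v \<in> W" for v
    proof -
      have "v - u \<in> U" using submodule_minus[OF U] v \<open>u \<in> U\<close> by blast
      moreover have "(f - u) - (f - v) \<in> W" using submodule_minus[OF W] v \<open>f - u \<in> W\<close> by blast
      then have "v - u \<in> W" by simp
      ultimately have "v - u = 0" using UW by blast
      then show ?thesis by simp
    qed
    then have "(THE v. v \<in> U \<and> f - v \<in> W) = u"
      using that by (intro the_equality) blast+
    then show ?thesis using \<open>f \<in> M\<close> by (simp add: E_def)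
  qed
  have E_in: "E f \<in> U" "f - E f \<in> W" if f: "f \<in> M" for f
  proof -
    obtain u w where uw: "f = u + w" "u \<in> U" "w \<in> W" using f sum by blast
    then have "E f = u" by (intro E_eq) simp_all
    then show "E f \<in> U" "f - E f \<in> W" using uw by simp_all
  qed
  have Uc: "f + g \<in> U" "(\<lambda>s. c * f s) \<in> U" if "f \<in> U" "g \<in> U" for f g c
    using U that unfolding submodule_def by blast+
  have Wc: "f + g \<in> W" "(\<lambda>s. c * f s) \<in> W" if "f \<in> W" "g \<in> W" for f g c
    using W that unfolding submodule_def by blast+
  have "E \<in> Endo n M"
    unfolding Endo_def
  proof (intro CollectI conjI ballI allI impI)
    fix f assume f: "f \<in> M"
    show "E f \<in> M" using E_in(1)[OF f] UM by blast
    show "E (\<lambda>s. c * f s) = (\<lambda>s. c * E f s)" for c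
    proof (rule E_eq)
      show "(\<lambda>s. c * E f s) \<in> U" using Uc(2) E_in(1)[OF f] by blast
      have "(\<lambda>s. c * (f - E f) s) \<in> W" using Wc(2) E_in(2)[OF f] by blast
      also have "(\<lambda>s. c * (f - E f) s) = (\<lambda>s. c * f s) - (\<lambda>s. c * E f s)"
        by (auto simp: fun_eq_iff right_diff_distrib)
      finally show "(\<lambda>s. c * f s) - (\<lambda>s. c * E f s) \<in> W" .
    qed
    show "E (f + g) = E f + E g" if g: "g \<in> M" for g
    proof (rule E_eq)
      show "E f + E g \<in> U" using Uc(1) E_in(1) f g by blast
      have "(f - E f) + (g - E g) \<in> W" using Wc(1) E_in(2) f g by blast
      then show "f + g - (E f + E g) \<in> W" by (simp add: algebra_simps)
    qed
    show "E (act g f) = act g (E f)" if g: "g \<in> Sym n" for g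
    proof (rule E_eq)
      show "act g (E f) \<in> U" using U E_in(1)[OF f] g unfolding submodule_def by blast
      have "act g (f - E f) \<in> W" using W E_in(2)[OF f] g unfolding submodule_def by blast
      also have "act g (f - E f) = act g f - act g (E f)" by (auto simp: act_def fun_eq_iff)
      finally show "act g f - act g (E f) \<in> W" .
    qed
  qed (auto simp: E_def)
  moreover have EU: "E u = u" if "u \<in> U" for u using that W0 by (intro E_eq) simp_all
  have "E \<circ> E = E"
  proof
    fix f show "(E \<circ> E) f = E f"
    proof (cases "f \<in> M")
      case True
      then show ?thesis using EU E_in(1) by simp
    next
      case False
      then show ?thesis using EU[OF U0] by (simp add: E_def)
    qed
  qed
  ultimately consider "E = 0" | "E = idM M" using idem by blast
  then show "U = {0} \<or> W = {0}"
  proof cases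
    case 1
    then have "U \<subseteq> {0}" using EU by force
    then show ?thesis using U0 by blast
  next
    case 2
    have "w = 0" if "w \<in> W" for w
    proof -
      have "E w = 0" using that U0 by (intro E_eq) simp_all
      moreover have "E w = w" using 2 that WM by (auto simp: idM_def)
      ultimately show ?thesis by simp
    qed
    then show ?thesis using W0 by blast
  qed
qed (rule assms(1))

text \<open>\<open>M\<close> is the direct sum of the kernel and the fixed space of
  \<open>E\<close>, by \<open>f = (f - E f) + E f\<close>; the vectors \<open>v\<close> and
  \<open>E w\<close> show that both summands are nonzero.\<close>

lemma not_indecomposable_if_idempotent:
  assumes M: "submodule n M M"
    and EM: "\<And>f. f \<in> M \<Longrightarrow> E f \<in> M"
    and add: "\<And>f g. f \<in> M \<Longrightarrow> g \<in> M \<Longrightarrow> E (f + g) = E f + E g"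
    and scal: "\<And>c f. f \<in> M \<Longrightarrow> E (\<lambda>s. c * f s) = (\<lambda>s. c * E f s)"
    and act: "\<And>g f. g \<in> Sym n \<Longrightarrow> f \<in> M \<Longrightarrow> E (act g f) = act g (E f)"
    and idem: "\<And>f. f \<in> M \<Longrightarrow> E (E f) = E f"
    and v: "v \<in> M" "v \<noteq> 0" "E v = 0" and w: "w \<in> M" "E w \<noteq> 0"
  shows "\<not> indecomposable n M"
proof
  assume ind: "indecomposable n M"
  define U where "U = {f \<in> M. E f = 0}"
  define W where "W = {f \<in> M. E f = f}"
  have Mc: "0 \<in> M" "\<And>f g. f \<in> M \<Longrightarrow> g \<in> M \<Longrightarrow> f + g \<in> M"
    "\<And>c f. f \<in> M \<Longrightarrow> (\<lambda>s. c * f s) \<in> M" "\<And>g f. g \<in> Sym n \<Longrightarrow> f \<in> M \<Longrightarrow> act g f \<in> M"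
    using M unfolding submodule_def by blast+
  have E0: "E 0 = 0" using add[OF Mc(1) Mc(1)] by simp
  have "submodule n M U" "submodule n M W"
    unfolding submodule_def U_def W_def
    by (auto simp: Mc E0 add scal act) (simp_all add: act_def fun_eq_iff)
  moreover have "U \<inter> W = {0}" unfolding U_def W_def using Mc E0 by auto
  moreover have "{u + w | u w. u \<in> U \<and> w \<in> W} = M"
  proof (intro equalityI subsetI)
    fix f assume f: "f \<in> M"
    have "f - E f \<in> M" using submodule_minus[OF M f EM[OF f]] .
    then have "E (f - E f) + E (E f) = E f" using add[of "f - E f" "E f"] EM[OF f] by simp
    then have "E (f - E f) = 0" using idem[OF f] by simp
    then have "f - E f \<in> U" "E f \<in> W" unfolding U_def W_def
      using \<open>f - E f \<in> M\<close> EM[OF f] idem[OF f] by auto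
    moreover have "f = (f - E f) + E f" by simp
    ultimately show "f \<in> {u + w | u w. u \<in> U \<and> w \<in> W}" by blast
  qed (auto simp: U_def W_def Mc)
  ultimately have "U = {0} \<or> W = {0}" using ind unfolding indecomposable_def by blast
  moreover have "v \<in> U" "E w \<in> W" unfolding U_def W_def using v w EM idem by auto
  ultimately show False using v w by auto
qed

text \<open>A Fitting argument: a suitable power of \<open>X\<close> is an idempotent, which kills the first vector
  but not the second one.\<close>
lemma not_indecomposable_if_two_eigenvalues:
  fixes M :: "(perm \<Rightarrow> 'a :: field) set" and l :: int
  assumes M: "submodule n M M" and char: "CHAR('a) > 0" and fin: "finite I"
    and t: "\<And>i. i \<in> I \<Longrightarrow> t i \<in> Sym n"
    and T: "\<And>f s. T f s = (\<Sum>i\<in>I. f (t i \<circ> s))"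
    and TM: "\<And>f. f \<in> M \<Longrightarrow> T f \<in> M"
    and v: "v \<in> M" "v \<noteq> 0" "T v = (\<lambda>s. of_int l * v s)"
    and w: "w \<in> M" "w \<noteq> 0" "T w = (\<lambda>s. m * w s)" and lm: "of_int l \<noteq> m"
  shows "\<not> indecomposable n M"
proof -
  \<comment> \<open>The eigenvalue shifted to 0 is an integer, so \<open>X\<close> is still an
    integral combination of translations. The other eigenvalue becomes \<open>m - of_int l\<close>,
    which is nonzero.\<close>
  define X where "X f = T f - (\<lambda>s. of_int l * f s)" for f
  have Mc: "0 \<in> M" "\<And>f g. f \<in> M \<Longrightarrow> g \<in> M \<Longrightarrow> f + g \<in> M"
    "\<And>c f. f \<in> M \<Longrightarrow> (\<lambda>s. c * f s) \<in> M" "\<And>g f. g \<in> Sym n \<Longrightarrow> f \<in> M \<Longrightarrow> act g f \<in> M"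
    using M unfolding submodule_def by blast+
  have XM: "X f \<in> M" if "f \<in> M" for f
    unfolding X_def using submodule_minus[OF M] TM Mc(3) that by blast
  have Xs: "X f s = (\<Sum>i\<in>I. f (t i \<circ> s)) - of_int l * f s" for f s
    by (simp add: X_def T)
  have "finite (range (\<lambda>k. X ^^ k))"
    using finite_powers_left_translations[OF char fin t Xs] .
  then obtain N where N: "0 < N" "X ^^ N \<circ> X ^^ N = X ^^ N" by (rule idempotent_power)
  have Xadd: "X (f + g) = X f + X g" for f g
    by (auto simp: fun_eq_iff Xs sum.distrib algebra_simps)
  have Xscal: "X (\<lambda>s. c * f s) = (\<lambda>s. c * X f s)" for c f
    by (auto simp: fun_eq_iff Xs sum_distrib_left algebra_simps)
  have Xact: "X (act g f) = act g (X f)" for g f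
    by (auto simp: fun_eq_iff Xs act_def comp_assoc)
  have Xw: "(X ^^ k) w = (\<lambda>s. (m - of_int l) ^ k * w s)" for k
  proof (induction k)
    case (Suc k)
    have "X w = (\<lambda>s. (m - of_int l) * w s)" unfolding X_def w(3) by (auto simp: algebra_simps)
    then show ?case using Suc by (simp add: Xscal mult.assoc mult.left_commute)
  qed simp
  show ?thesis
  proof (rule not_indecomposable_if_idempotent[OF M, of "X ^^ N" v w])
    show "(X ^^ N) f \<in> M" if "f \<in> M" for f using that by (induction N) (auto intro: XM)
    show "(X ^^ N) (f + g) = (X ^^ N) f + (X ^^ N) g" for f g
      by (induction N) (simp_all only: funpow.simps comp_apply id_apply Xadd)
    show "(X ^^ N) (\<lambda>s. c * f s) = (\<lambda>s. c * (X ^^ N) f s)" for c f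
      by (induction N) (auto simp: Xscal)
    show "(X ^^ N) (act g f) = act g ((X ^^ N) f)" for g f by (induction N) (auto simp: Xact)
    show "(X ^^ N) ((X ^^ N) f) = (X ^^ N) f" for f using N(2) by (auto simp: fun_eq_iff)
    \<comment> \<open>As \<open>N\<close> is positive, at least one factor \<open>X\<close> is
      applied to \<open>v\<close>.\<close>
    obtain N' where N': "N = Suc N'" using N(1) gr0_implies_Suc by blast
    have "X v = 0" by (auto simp: X_def v(3) fun_eq_iff)
    moreover have "(X ^^ k) 0 = 0" for k
      by (induction k) (auto simp: fun_eq_iff Xs)
    ultimately show "(X ^^ N) v = 0" by (simp only: N' funpow_Suc_right comp_apply)
    obtain s where "w s \<noteq> 0" using w(2) by (auto simp: fun_eq_iff)
    then have "(X ^^ N) w s \<noteq> 0" using lm by (simp add: Xw)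
    then show "(X ^^ N) w \<noteq> 0" by (auto simp: fun_eq_iff)
  qed (use v w in auto)
qed

section \<open>The induced module and its canonical generator\<close>

lemma Mmod_submodule: "submodule n (Mmod \<alpha> \<beta> n) (Mmod \<alpha> \<beta> n :: (perm \<Rightarrow> 'a :: field) set)"
  unfolding submodule_def Mmod_def
  by (auto simp: act_def Sym_comp_right_iff comp_assoc Sym_comp algebra_simps)

lemma Mmod_outside: "f \<in> Mmod \<alpha> \<beta> n \<Longrightarrow> s \<notin> Sym n \<Longrightarrow> f s = 0"
  unfolding Mmod_def by blast

lemma Mmod_left:
  assumes "f \<in> Mmod \<alpha> \<beta> n" "h \<in> young \<alpha> \<beta> n"
  shows "f (h \<circ> s) = chi \<alpha> h * f s"
proof (cases "s \<in> Sym n")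
  case True
  then show ?thesis using assms unfolding Mmod_def by blast
next
  case False
  then have "h \<circ> s \<notin> Sym n" using assms(2) young_subset_Sym Sym_comp_left_iff by blast
  then show ?thesis using False Mmod_outside[OF assms(1)] by simp
qed

text \<open>The canonical generator of the induced module. The supports of its translates are the
  cosets of the Young subgroup, and the translates span the module.\<close>

definition gen :: "nat list \<Rightarrow> nat list \<Rightarrow> nat \<Rightarrow> perm \<Rightarrow> 'a :: field" where
  "gen \<alpha> \<beta> n s = (if s \<in> young \<alpha> \<beta> n then chi \<alpha> s else 0)"

lemma gen_left:
  assumes "sum_list \<alpha> + sum_list \<beta> = n" "h \<in> young \<alpha> \<beta> n"
  shows "(gen \<alpha> \<beta> n (h \<circ> s) :: 'a :: field) = chi \<alpha> h * gen \<alpha> \<beta> n s"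
proof (cases "s \<in> young \<alpha> \<beta> n")
  case True
  then have "h \<in> side_stab \<alpha> n" "s \<in> side_stab \<alpha> n"
    using assms young_subset_side_stab by blast+
  then show ?thesis using True assms(2) by (simp add: gen_def young_comp_left_iff chi_comp)
qed (simp add: gen_def young_comp_left_iff assms(2))

text \<open>The group acts by right translation, so the generator spans a line on which the Young
  subgroup acts through its character.\<close>

lemma gen_right:
  assumes "sum_list \<alpha> + sum_list \<beta> = n" "h \<in> young \<alpha> \<beta> n"
  shows "(gen \<alpha> \<beta> n (s \<circ> h) :: 'a :: field) = chi \<alpha> h * gen \<alpha> \<beta> n s"
proof (cases "s \<in> young \<alpha> \<beta> n")
  case True
  then have "h \<in> side_stab \<alpha> n" "s \<in> side_stab \<alpha> n"
    using assms young_subset_side_stab by blast+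
  then show ?thesis using True assms(2) by (simp add: gen_def young_comp_right_iff chi_comp)
qed (simp add: gen_def young_comp_right_iff assms(2))

lemma gen_in_Mmod:
  assumes "sum_list \<alpha> + sum_list \<beta> = n"
  shows "(gen \<alpha> \<beta> n :: perm \<Rightarrow> 'a :: field) \<in> Mmod \<alpha> \<beta> n"
proof -
  have "(gen \<alpha> \<beta> n s :: 'a) = 0" if "s \<notin> Sym n" for s
    using that young_subset_Sym unfolding gen_def by auto
  then show ?thesis unfolding Mmod_def using gen_left[OF assms] by blast
qed

lemma gen_id: "gen \<alpha> \<beta> n id = 1"
  by (simp add: gen_def young_id chi_id)

lemma Mmod_nonzero:
  assumes "sum_list \<alpha> + sum_list \<beta> = n"
  shows "Mmod \<alpha> \<beta> n \<noteq> {0 :: perm \<Rightarrow> 'a :: field}"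
proof
  assume "Mmod \<alpha> \<beta> n = {0 :: perm \<Rightarrow> 'a}"
  then have "(gen \<alpha> \<beta> n :: perm \<Rightarrow> 'a) = 0" using gen_in_Mmod[OF assms, where 'a = 'a] by simp
  then have "(gen \<alpha> \<beta> n :: perm \<Rightarrow> 'a) id = 0" by simp
  then show False using gen_id[where 'a = 'a] by simp
qed

section \<open>The sum of the transpositions between two blocks\<close>

lemma transpose_comp_inj:
  assumes "inj h"
  shows "transpose (h x) (h y) \<circ> h = h \<circ> transpose x y"
  using assms by (auto simp: fun_eq_iff transpose_def inj_eq)

text \<open>Exchanging the partners in two disjoint swaps costs one transposition of
  \<open>x\<close> with \<open>x'\<close> and one of \<open>y\<close> with \<open>y'\<close>. If
  these pairs lie in blocks, the character of both is known.\<close>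

lemma transpose_crossing:
  assumes "distinct [x, x', y, y']"
  shows "transpose x' y' \<circ> transpose x y
    = transpose x x' \<circ> (transpose y y' \<circ> (transpose x' y \<circ> transpose x y'))"
proof
  fix z
  consider "z = x" | "z = x'" | "z = y" | "z = y'" | "z \<notin> {x, x', y, y'}" by blast
  then show "(transpose x' y' \<circ> transpose x y) z
    = (transpose x x' \<circ> (transpose y y' \<circ> (transpose x' y \<circ> transpose x y'))) z"
    using assms by cases (auto simp: transpose_def)
qed

definition swap_op :: "nat set \<Rightarrow> nat set \<Rightarrow> (perm \<Rightarrow> 'a :: field) \<Rightarrow> perm \<Rightarrow> 'a" where
  "swap_op A B f s = (\<Sum>x\<in>A. \<Sum>y\<in>B. f (transpose x y \<circ> s))"

text \<open>The sets are abstracted from their positions in the list of blocks, so that one argument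
  serves for every pair and for both signs.\<close>

locale young_pair =
  fixes \<alpha> \<beta> :: "nat list" and n :: nat and A B :: "nat set" and e e' :: "'a :: field"
  assumes n_eq: "sum_list \<alpha> + sum_list \<beta> = n"
    and A_sub: "A \<subseteq> {1..n}" and B_sub: "B \<subseteq> {1..n}" and disj: "A \<inter> B = {}"
    and A_ne: "A \<noteq> {}" and B_ne: "B \<noteq> {}"
    and A_stab: "h \<in> young \<alpha> \<beta> n \<Longrightarrow> h ` A = A"
    and B_stab: "h \<in> young \<alpha> \<beta> n \<Longrightarrow> h ` B = B"
    and A_swap: "x \<in> A \<Longrightarrow> y \<in> A \<Longrightarrow> transpose x y \<in> young \<alpha> \<beta> n"
    and B_swap: "x \<in> B \<Longrightarrow> y \<in> B \<Longrightarrow> transpose x y \<in> young \<alpha> \<beta> n"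
    and A_chi: "x \<in> A \<Longrightarrow> y \<in> A \<Longrightarrow> x \<noteq> y \<Longrightarrow> chi \<alpha> (transpose x y) = e"
    and B_chi: "x \<in> B \<Longrightarrow> y \<in> B \<Longrightarrow> x \<noteq> y \<Longrightarrow> chi \<alpha> (transpose x y) = e'"
    and e_square: "e * e = 1"
begin

abbreviation "M \<equiv> (Mmod \<alpha> \<beta> n :: (perm \<Rightarrow> 'a) set)"
abbreviation "H \<equiv> young \<alpha> \<beta> n"
abbreviation "\<delta> \<equiv> (gen \<alpha> \<beta> n :: perm \<Rightarrow> 'a)"
abbreviation "T \<equiv> (swap_op A B :: (perm \<Rightarrow> 'a) \<Rightarrow> perm \<Rightarrow> 'a)"

lemma fin: "finite A" "finite B"
  using A_sub B_sub finite_subset by blast+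

lemma swap_Sym: "x \<in> A \<Longrightarrow> y \<in> B \<Longrightarrow> transpose x y \<in> Sym n"
  using A_sub B_sub transpose_in_Sym by blast

text \<open>Conjugation by an element of the Young subgroup permutes the swaps between
  \<open>A\<close> and \<open>B\<close>, so their sum commutes with it.\<close>

lemma T_Mmod:
  assumes f: "f \<in> M"
  shows "T f \<in> M"
  unfolding Mmod_def
proof (intro CollectI conjI allI ballI impI)
  fix s assume "s \<notin> Sym n"
  then have "f (transpose x y \<circ> s) = 0" if "x \<in> A" "y \<in> B" for x y
    using Mmod_outside[OF f] Sym_comp_left_iff[OF swap_Sym[OF that]] by blast
  then show "T f s = 0" by (simp add: swap_op_def)
next
  fix h s assume h: "h \<in> H"
  have inj: "inj h" using h young_subset_Sym Sym_inj by blast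
  have hA: "bij_betw h A A" and hB: "bij_betw h B B"
    using A_stab[OF h] B_stab[OF h] inj by (auto simp: bij_betw_def intro: inj_on_subset)
  have "T f (h \<circ> s) = (\<Sum>x\<in>A. \<Sum>y\<in>B. f (transpose (h x) (h y) \<circ> (h \<circ> s)))"
    unfolding swap_op_def
    by (subst sum.reindex_bij_betw[OF hA, symmetric], subst sum.reindex_bij_betw[OF hB, symmetric])
      (rule refl)
  also have "\<dots> = (\<Sum>x\<in>A. \<Sum>y\<in>B. f (h \<circ> (transpose x y \<circ> s)))"
    by (simp add: transpose_comp_inj[OF inj] flip: comp_assoc)
  also have "\<dots> = chi \<alpha> h * T f s"
    by (simp add: Mmod_left[OF f h] swap_op_def sum_distrib_left)
  finally show "T f (h \<circ> s) = chi \<alpha> h * T f s" .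
qed

lemma T_linear:
  "T (f + g) = T f + T g" "T (\<lambda>s. c * f s) = (\<lambda>s. c * T f s)" "T (act r f) = act r (T f)"
  by (auto simp: fun_eq_iff swap_op_def act_def comp_assoc sum.distrib sum_distrib_left)

text \<open>The values at \<open>id\<close> and at a swap serve as coordinates: they are (1, 0) for
  \<open>\<delta>\<close> and (0, 1) for \<open>T \<delta>\<close>, so these two vectors are
  linearly independent.\<close>

lemma T_gen_at_id: "T \<delta> id = 0"
proof -
  have "transpose x y \<notin> H" if "x \<in> A" "y \<in> B" for x y
    using A_stab[of "transpose x y"] that disj by (metis IntI empty_iff imageI transpose_apply_first)
  then show ?thesis by (simp add: swap_op_def gen_def)
qed

lemma gen_at_swap:
  assumes "x \<in> A" "y \<in> B"
  shows "\<delta> (transpose x y) = 0"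
  using A_stab[of "transpose x y"] assms disj
  by (metis IntI empty_iff imageI transpose_apply_first gen_def)

lemma T_gen_at_swap:
  assumes x0: "x0 \<in> A" and y0: "y0 \<in> B"
  shows "T \<delta> (transpose x0 y0) = 1"
proof -
  have "\<delta> (transpose x y \<circ> transpose x0 y0) = (if y = y0 then if x = x0 then 1 else 0 else 0)"
    if x: "x \<in> A" and y: "y \<in> B" for x y
  proof (cases "x = x0 \<and> y = y0")
    case True
    then show ?thesis using gen_id[where 'a = 'a] by simp
  next
    case False
    have ne: "x0 \<noteq> y0" "x \<noteq> y0" "x0 \<noteq> y" "x \<noteq> y" using x y x0 y0 disj by auto
    have "transpose x y \<circ> transpose x0 y0 \<notin> H"
    proof
      \<comment> \<open>The product sends \<open>x0\<close> to \<open>transpose x y y0\<close> and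
        \<open>y0\<close> to \<open>transpose x y x0\<close>; preserving \<open>A\<close> and
        \<open>B\<close> leaves only the factor that undoes the swap.\<close>
      assume h: "transpose x y \<circ> transpose x0 y0 \<in> H"
      have "transpose x y y0 \<in> A" using A_stab[OF h] x0 by force
      then have "y = y0" using y0 disj ne by (auto simp: transpose_def split: if_splits)
      moreover have "transpose x y x0 \<in> B" using B_stab[OF h] y0 by force
      then have "x = x0" using x0 disj ne by (auto simp: transpose_def split: if_splits)
      ultimately show False using False by simp
    qed
    then show ?thesis using False by (auto simp: gen_def)
  qed
  then show ?thesis using fin x0 y0 by (simp add: swap_op_def)
qed

text \<open>Products of two transpositions with four distinct entries cancel in pairs, because
  \<open>(x' y')(x y) = (x x')(y y')(x y')(x' y)\<close> and the two types of swaps have opposite signs.\<close>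
lemma T_square:
  assumes opp: "e' = - e" and two: "(2 :: 'a) \<noteq> 0" and f: "f \<in> M"
  shows "T (T f) = (\<lambda>s. of_nat (card A) * of_nat (card B) * f s
    + e * (of_nat (card A) - of_nat (card B)) * T f s)"
proof
  fix s
  \<comment> \<open>The general term of \<open>T (T f) s\<close>. It is evaluated according to which
    entries the two swaps share.\<close>
  define F where "F x y x' y' = f (transpose x' y' \<circ> (transpose x y \<circ> s))" for x y x' y'
  define g where "g x y = f (transpose x y \<circ> s)" for x y
  have Tg: "T f s = (\<Sum>x\<in>A. \<Sum>y\<in>B. g x y)" by (simp add: swap_op_def g_def)
  have F1: "F x y x y = f s" for x y by (simp add: F_def flip: comp_assoc)
  \<comment> \<open>With \<open>x\<close> in common, the product of the swaps is one swap up to a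
    transposition of \<open>B\<close>; \<open>F3\<close> is the analogue for
    \<open>A\<close>.\<close>
  have F2: "F x y x y' = - e * g x y'" if "x \<in> A" "y \<in> B" "y' \<in> B" "y \<noteq> y'" for x y y'
  proof -
    have "x \<noteq> y" "x \<noteq> y'" using that disj by auto
    then have "transpose x y' \<circ> (transpose x y \<circ> s) = transpose y y' \<circ> (transpose x y' \<circ> s)"
      using that by (auto simp: fun_eq_iff transpose_def)
    then show ?thesis unfolding F_def g_def
      using Mmod_left[OF f B_swap[OF that(2,3)]] B_chi[OF that(2-4)] opp by simp
  qed
  have F3: "F x y x' y = e * g x' y" if "x \<in> A" "x' \<in> A" "y \<in> B" "x \<noteq> x'" for x x' y
  proof -
    have "x \<noteq> y" "x' \<noteq> y" using that disj by auto
    then have "transpose x' y \<circ> (transpose x y \<circ> s) = transpose x x' \<circ> (transpose x' y \<circ> s)"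
      using that by (auto simp: fun_eq_iff transpose_def)
    then show ?thesis unfolding F_def g_def
      using Mmod_left[OF f A_swap[OF that(1,2)]] A_chi[OF that(1,2,4)] by simp
  qed
  have F4: "F x y x' y' = - F x y' x' y"
    if "x \<in> A" "x' \<in> A" "y \<in> B" "y' \<in> B" "x \<noteq> x'" "y \<noteq> y'" for x x' y y'
  proof -
    have "x \<noteq> y" "x' \<noteq> y" "x \<noteq> y'" "x' \<noteq> y'" using that disj by auto
    then have "transpose x' y' \<circ> transpose x y \<circ> s
        = transpose x x' \<circ> (transpose y y' \<circ> (transpose x' y \<circ> transpose x y')) \<circ> s"
      using that by (subst transpose_crossing) auto
    then have "transpose x' y' \<circ> (transpose x y \<circ> s)
        = transpose x x' \<circ> (transpose y y' \<circ> (transpose x' y \<circ> (transpose x y' \<circ> s)))"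
      by (simp only: comp_assoc)
    then have "F x y x' y' = e * (- e * F x y' x' y)" unfolding F_def
      using Mmod_left[OF f A_swap[OF that(1,2)]] A_chi[OF that(1,2,5)]
        Mmod_left[OF f B_swap[OF that(3,4)]] B_chi[OF that(3,4,6)] opp by simp
    then show ?thesis using e_square by (simp flip: mult.assoc)
  qed
  \<comment> \<open>The contribution of the pairs of disjoint swaps, which will turn out to
    cancel.\<close>
  define Q where "Q = (\<Sum>x\<in>A. \<Sum>y\<in>B. \<Sum>x'\<in>A - {x}. \<Sum>y'\<in>B - {y}. F x y x' y')"
  have "(\<Sum>x'\<in>A. \<Sum>y'\<in>B. F x y x' y')
      = f s - e * ((\<Sum>y'\<in>B. g x y') - g x y) + e * ((\<Sum>x'\<in>A. g x' y) - g x y)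
        + (\<Sum>x'\<in>A - {x}. \<Sum>y'\<in>B - {y}. F x y x' y')" if x: "x \<in> A" and y: "y \<in> B" for x y
  proof -
    have "(\<Sum>y'\<in>B. F x y x y') = f s + (\<Sum>y'\<in>B - {y}. - e * g x y')"
      unfolding sum.remove[OF fin(2) y] F1
      by (intro arg_cong2[where f = "(+)"] sum.cong refl F2) (use x y in auto)
    also have "\<dots> = f s - e * ((\<Sum>y'\<in>B. g x y') - g x y)"
      unfolding sum.remove[OF fin(2) y, of "g x"] by (simp add: sum_distrib_left sum_negf)
    finally have r: "(\<Sum>y'\<in>B. F x y x y') = f s - e * ((\<Sum>y'\<in>B. g x y') - g x y)" .
    have "(\<Sum>x'\<in>A - {x}. \<Sum>y'\<in>B. F x y x' y')
        = (\<Sum>x'\<in>A - {x}. e * g x' y + (\<Sum>y'\<in>B - {y}. F x y x' y'))"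
      unfolding sum.remove[OF fin(2) y] using x y by (auto intro!: sum.cong F3)
    also have "\<dots> = e * ((\<Sum>x'\<in>A. g x' y) - g x y) + (\<Sum>x'\<in>A - {x}. \<Sum>y'\<in>B - {y}. F x y x' y')"
      unfolding sum.remove[OF fin(1) x, of "\<lambda>x'. g x' y"]
      by (simp add: sum_distrib_left sum.distrib)
    finally show ?thesis unfolding sum.remove[OF fin(1) x, of "\<lambda>x'. \<Sum>y'\<in>B. F x y x' y'"] r
      by (simp add: algebra_simps)
  qed
  then have "T (T f) s = (\<Sum>x\<in>A. \<Sum>y\<in>B. f s - e * ((\<Sum>y'\<in>B. g x y') - g x y)
      + e * ((\<Sum>x'\<in>A. g x' y) - g x y) + (\<Sum>x'\<in>A - {x}. \<Sum>y'\<in>B - {y}. F x y x' y'))"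
    by (simp add: swap_op_def F_def)
  also have "\<dots> = of_nat (card A) * of_nat (card B) * f s - e * (of_nat (card B) * T f s - T f s)
      + e * (of_nat (card A) * T f s - T f s) + Q"
  proof -
    have "(\<Sum>x\<in>A. \<Sum>y\<in>B. \<Sum>x'\<in>A. g x' y) = of_nat (card A) * T f s"
      unfolding Tg sum.swap[of _ A B] by simp
    moreover have "(\<Sum>x\<in>A. \<Sum>y\<in>B. \<Sum>y'\<in>B. g x y') = of_nat (card B) * T f s"
      unfolding Tg by (simp add: sum_distrib_left)
    ultimately show ?thesis
      unfolding Q_def by (simp add: sum.distrib sum_subtractf Tg flip: sum_distrib_left)
  qed
  also have "Q = 0"
  proof -
    \<comment> \<open>Filling the diagonal with 0 turns the inner sum into a full double sum, which
      is antisymmetric under exchange of \<open>y\<close> and \<open>y'\<close> by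
      \<open>F4\<close>.\<close>
    define D where "D x x' y y' = (if y = y' then 0 else F x y x' y')" for x x' y y'
    have D: "(\<Sum>y\<in>B. \<Sum>y'\<in>B. D x x' y y') = 0" if "x \<in> A" "x' \<in> A - {x}" for x x'
    proof -
      have "(\<Sum>y\<in>B. \<Sum>y'\<in>B. D x x' y y') = (\<Sum>y'\<in>B. \<Sum>y\<in>B. - D x x' y' y)"
        by (subst sum.swap, intro sum.cong refl) (use that in \<open>auto simp: D_def intro: F4\<close>)
      then have "2 * (\<Sum>y\<in>B. \<Sum>y'\<in>B. D x x' y y') = 0" by (simp add: sum_negf)
      then show ?thesis using two by simp
    qed
    have "(\<Sum>y'\<in>B - {y}. F x y x' y') = (\<Sum>y'\<in>B. D x x' y y')" if "y \<in> B" for x x' y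
      by (rule sum.mono_neutral_cong_left) (auto simp: D_def fin)
    then have "Q = (\<Sum>x\<in>A. \<Sum>y\<in>B. \<Sum>x'\<in>A - {x}. \<Sum>y'\<in>B. D x x' y y')"
      unfolding Q_def by simp
    also have "\<dots> = (\<Sum>x\<in>A. \<Sum>x'\<in>A - {x}. \<Sum>y\<in>B. \<Sum>y'\<in>B. D x x' y y')"
      by (intro sum.cong refl sum.swap)
    finally show ?thesis using D by simp
  qed
  finally show "T (T f) s = of_nat (card A) * of_nat (card B) * f s
    + e * (of_nat (card A) - of_nat (card B)) * T f s"
    by (simp add: algebra_simps)
qed

text \<open>By \<open>T_square\<close> the roots are \<open>e * a\<close> and
  \<open>- e * b\<close>. Subtracting one root times \<open>\<delta>\<close> from
  \<open>T \<delta>\<close> gives an eigenvector for the other root, and the roots differ when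
  \<open>a + b\<close> is nonzero.\<close>

lemma not_indecomposable_if_opposite:
  assumes opp: "e' = - e" and char: "CHAR('a) > 2"
    and card: "\<not> CHAR('a) dvd card A + card B"
  shows "\<not> indecomposable n M"
proof -
  have two: "(2 :: 'a) \<noteq> 0"
    using of_nat_eq_0_iff_char_dvd[of 2, where 'a = 'a] char by (auto dest: dvd_imp_le)
  define a b where "a = (of_nat (card A) :: 'a)" and "b = (of_nat (card B) :: 'a)"
  have ab: "a + b \<noteq> 0"
    using of_nat_eq_0_iff_char_dvd[of "card A + card B", where 'a = 'a] card by (simp add: a_def b_def)
  have e: "e = 1 \<or> e = - 1" using e_square by (simp add: square_eq_1_iff)
  \<comment> \<open>An integer lift of \<open>e * a\<close>, as the Fitting argument needs an
    integral eigenvalue.\<close>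
  define l :: int where "l = (if e = 1 then int (card A) else - int (card A))"
  have l: "of_int l = e * a" using e by (auto simp: l_def a_def)
  obtain x0 y0 where xy: "x0 \<in> A" "y0 \<in> B" using A_ne B_ne by blast
  define v where "v c = T \<delta> - (\<lambda>s. c * \<delta> s)" for c
  have M\<delta>: "\<delta> \<in> M" by (rule gen_in_Mmod[OF n_eq])
  have v_M: "v c \<in> M" for c
  proof -
    have "(\<lambda>s. c * \<delta> s) \<in> M" using M\<delta> Mmod_submodule[of n \<alpha> \<beta>] unfolding submodule_def by blast
    then show ?thesis unfolding v_def by (intro submodule_minus[OF Mmod_submodule] T_Mmod M\<delta>)
  qed
  have v_ne: "v c \<noteq> 0" for c
  proof
    assume "v c = 0"
    then have "v c (transpose x0 y0) = 0" by simp
    then show False by (simp add: v_def T_gen_at_swap[OF xy] gen_at_swap[OF xy])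
  qed
  have Tv: "T (v c) = (\<lambda>s. a * b * \<delta> s + (e * (a - b) - c) * T \<delta> s)" for c
  proof
    fix s
    have "T (v c) s = T (T \<delta>) s - c * T \<delta> s"
      unfolding v_def by (simp add: swap_op_def sum_subtractf sum_distrib_left)
    then show "T (v c) s = a * b * \<delta> s + (e * (a - b) - c) * T \<delta> s"
      unfolding T_square[OF opp two M\<delta>] by (simp add: a_def b_def algebra_simps)
  qed
  have ee: "e * (e * z) = z" for z using e_square by (simp flip: mult.assoc)
  show ?thesis
  proof (rule not_indecomposable_if_two_eigenvalues[OF Mmod_submodule, where I = "A \<times> B"
        and t = "\<lambda>(x, y). transpose x y" and T = T and l = l and m = "- e * b"])
    show "T (v (- e * b)) = (\<lambda>s. of_int l * v (- e * b) s)"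
      unfolding Tv l by (simp add: fun_eq_iff v_def algebra_simps ee)
    show "T (v (e * a)) = (\<lambda>s. - e * b * v (e * a) s)"
      unfolding Tv by (simp add: fun_eq_iff v_def algebra_simps ee)
    have "e * a - (- e * b) = e * (a + b)" by (simp add: algebra_simps)
    also have "\<dots> \<noteq> 0" using ab e by auto
    finally show "of_int l \<noteq> - e * b" unfolding l by auto
    show "T f s = (\<Sum>i\<in>A \<times> B. f ((case i of (x, y) \<Rightarrow> transpose x y) \<circ> s))" for f s
      by (simp add: swap_op_def sum.cartesian_product case_prod_beta)
  qed (use char fin swap_Sym v_M v_ne T_Mmod in auto)
qed

end

section \<open>Endomorphisms and the image of the generator\<close>

lemma EndoD:
  assumes "\<phi> \<in> Endo n M"
  shows "f \<in> M \<Longrightarrow> \<phi> f \<in> M" "f \<notin> M \<Longrightarrow> \<phi> f = 0"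
    "f \<in> M \<Longrightarrow> g \<in> M \<Longrightarrow> \<phi> (f + g) = \<phi> f + \<phi> g"
    "f \<in> M \<Longrightarrow> \<phi> (\<lambda>s. c * f s) = (\<lambda>s. c * \<phi> f s)"
    "r \<in> Sym n \<Longrightarrow> f \<in> M \<Longrightarrow> \<phi> (act r f) = act r (\<phi> f)"
  using assms unfolding Endo_def by auto

text \<open>The translates of the generator span the module: subtracting a multiple of the translate
  supported on the coset of \<open>s0\<close> removes this coset from the support of
  \<open>f\<close>.\<close>

lemma Endo_determined_by_gen:
  fixes \<phi> \<psi> :: "(perm \<Rightarrow> 'a :: field) \<Rightarrow> perm \<Rightarrow> 'a"
  assumes n: "sum_list \<alpha> + sum_list \<beta> = n"
    and \<phi>: "\<phi> \<in> Endo n (Mmod \<alpha> \<beta> n)" and \<psi>: "\<psi> \<in> Endo n (Mmod \<alpha> \<beta> n)"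
    and eq: "\<phi> (gen \<alpha> \<beta> n) = \<psi> (gen \<alpha> \<beta> n)"
  shows "\<phi> = \<psi>"
proof
  fix f
  let ?M = "Mmod \<alpha> \<beta> n :: (perm \<Rightarrow> 'a) set" and ?\<delta> = "gen \<alpha> \<beta> n :: perm \<Rightarrow> 'a"
  note M = Mmod_submodule[of n \<alpha> \<beta>, where 'a = 'a]
  have \<delta>: "?\<delta> \<in> ?M" by (rule gen_in_Mmod[OF n])
  have zero: "0 \<in> ?M" using M unfolding submodule_def by blast
  have agree: "f \<in> ?M \<Longrightarrow> \<phi> f = \<psi> f"
  proof (induction "card {s \<in> Sym n. f s \<noteq> 0}" arbitrary: f rule: less_induct)
    case (less f)
    show ?case
    proof (cases "f = 0")
      case True
      then show ?thesis
        using EndoD(3)[OF \<phi> zero zero] EndoD(3)[OF \<psi> zero zero] by simp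
    next
      case False
      then obtain s0 where s0: "f s0 \<noteq> 0" by (auto simp: fun_eq_iff)
      then have s0S: "s0 \<in> Sym n" using Mmod_outside[OF less.prems] by blast
      let ?d = "act (inv s0) ?\<delta>" and ?cd = "\<lambda>s. f s0 * act (inv s0) ?\<delta> s"
      have d: "?d \<in> ?M" using M \<delta> Sym_inv[OF s0S] unfolding submodule_def by blast
      then have cd: "?cd \<in> ?M" using M unfolding submodule_def by blast
      have f': "f - ?cd \<in> ?M" by (rule submodule_minus[OF M less.prems cd])
      \<comment> \<open>Nothing is added to the support, since \<open>f\<close> has no zero on the
        coset of \<open>s0\<close>.\<close>
      have keep: "(f - ?cd) s = 0" if "f s = 0" for s
      proof -
        have "s \<circ> inv s0 \<notin> young \<alpha> \<beta> n"
        proof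
          assume h: "s \<circ> inv s0 \<in> young \<alpha> \<beta> n"
          have "f (s \<circ> inv s0 \<circ> s0) = chi \<alpha> (s \<circ> inv s0) * f s0"
            by (rule Mmod_left[OF less.prems h])
          then have "chi \<alpha> (s \<circ> inv s0) = (0 :: 'a)"
            using that s0 by (simp add: comp_assoc Sym_inv_o[OF s0S])
          then show False using chi_square[of \<alpha> "s \<circ> inv s0", where 'a = 'a] by simp
        qed
        then show ?thesis using that by (simp add: act_def gen_def)
      qed
      have "(f - ?cd) s0 = 0"
        by (simp add: act_def Sym_inv_o[OF s0S] gen_id)
      then have "{s \<in> Sym n. (f - ?cd) s \<noteq> 0} \<subset> {s \<in> Sym n. f s \<noteq> 0}"
        using keep s0 s0S by blast
      then have "card {s \<in> Sym n. (f - ?cd) s \<noteq> 0} < card {s \<in> Sym n. f s \<noteq> 0}"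
        using finite_Sym by (intro psubset_card_mono) auto
      then have "\<phi> (f - ?cd) = \<psi> (f - ?cd)" using less.hyps f' by blast
      moreover have "\<phi> ?cd = \<psi> ?cd"
        using EndoD(4,5)[OF \<phi>] EndoD(4,5)[OF \<psi>] d \<delta> eq Sym_inv[OF s0S] by simp
      moreover have "f = (f - ?cd) + ?cd" by simp
      ultimately show ?thesis
        using EndoD(3)[OF \<phi> f' cd] EndoD(3)[OF \<psi> f' cd] by metis
    qed
  qed
  then show "\<phi> f = \<psi> f" using EndoD(2)[OF \<phi>, of f] EndoD(2)[OF \<psi>, of f] by (cases "f \<in> ?M") auto
qed

text \<open>The easy half of Frobenius reciprocity: the image of the generator transforms under the
  Young subgroup as the generator does.\<close>

lemma Endo_gen_right:
  fixes \<phi> :: "(perm \<Rightarrow> 'a :: field) \<Rightarrow> perm \<Rightarrow> 'a"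
  assumes n: "sum_list \<alpha> + sum_list \<beta> = n" and \<phi>: "\<phi> \<in> Endo n (Mmod \<alpha> \<beta> n)"
    and h: "h \<in> young \<alpha> \<beta> n"
  shows "\<phi> (gen \<alpha> \<beta> n) (s \<circ> h) = chi \<alpha> h * \<phi> (gen \<alpha> \<beta> n) s"
proof -
  have "act h (gen \<alpha> \<beta> n) = (\<lambda>s. chi \<alpha> h * gen \<alpha> \<beta> n s :: 'a)"
    by (auto simp: act_def gen_right[OF n h])
  moreover have "h \<in> Sym n" using h young_subset_Sym by blast
  ultimately have "act h (\<phi> (gen \<alpha> \<beta> n)) = (\<lambda>s. chi \<alpha> h * \<phi> (gen \<alpha> \<beta> n) s)"
    using EndoD(4,5)[OF \<phi>] gen_in_Mmod[OF n] by metis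
  then show ?thesis by (simp add: act_def fun_eq_iff)
qed

lemma mod_square_linear:
  fixes a b c d :: "'a :: field"
  shows "([:a, b:] * [:c, d:]) mod [:0, 0, 1:] = [:a * c, a * d + b * c:]"
proof -
  have "[:a, b:] * [:c, d:] = [:a * c, a * d + b * c:] + [:b * d:] * [:0, 0, 1:]"
    by (simp add: algebra_simps)
  then have "([:a, b:] * [:c, d:]) mod [:0, 0, 1:] = [:a * c, a * d + b * c:] mod [:0, 0, 1:]"
    by (simp only: mod_mult_self1)
  also have "\<dots> = [:a * c, a * d + b * c:]" by (rule mod_poly_less) simp
  finally show ?thesis .
qed

text \<open>The module is one-dimensional, as an equivariant function is determined by its value at
  \<open>id\<close>; all endomorphisms are scalars.\<close>

lemma full_young_Endo:
  fixes M :: "(perm \<Rightarrow> 'a :: field) set"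
  assumes n: "sum_list \<alpha> + sum_list \<beta> = n" and full: "young \<alpha> \<beta> n = Sym n"
  defines "M \<equiv> Mmod \<alpha> \<beta> n"
  shows "End_iso_F n M" "indecomposable n M"
proof -
  let ?\<delta> = "gen \<alpha> \<beta> n :: perm \<Rightarrow> 'a"
  define E where "E x f = (if f \<in> M then (\<lambda>s. x * f s) else 0)" for x :: 'a and f
  have sub: "submodule n M M" unfolding M_def by (rule Mmod_submodule)
  have \<delta>: "?\<delta> \<in> M" unfolding M_def by (rule gen_in_Mmod[OF n])
  have Mc: "0 \<in> M" "\<And>f g. f \<in> M \<Longrightarrow> g \<in> M \<Longrightarrow> f + g \<in> M"
    "\<And>c f. f \<in> M \<Longrightarrow> (\<lambda>s. c * f s) \<in> M" "\<And>g f. g \<in> Sym n \<Longrightarrow> f \<in> M \<Longrightarrow> act g f \<in> M"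
    using sub unfolding submodule_def by blast+
  have EE: "E x \<in> Endo n M" for x
    unfolding Endo_def E_def using Mc by (auto simp: fun_eq_iff act_def algebra_simps)
  have E_ex: "\<exists>x. \<phi> = E x" if \<phi>: "\<phi> \<in> Endo n M" for \<phi>
  proof
    have "\<phi> ?\<delta> s = E (\<phi> ?\<delta> id) ?\<delta> s" for s
    proof (cases "s \<in> Sym n")
      case True
      then show ?thesis using Mmod_left[of "\<phi> ?\<delta>" \<alpha> \<beta> n s id] EndoD(1)[OF \<phi> \<delta>] \<delta> full
        by (simp add: E_def M_def gen_def)
    next
      case False
      then show ?thesis using Mmod_outside[of "\<phi> ?\<delta>" \<alpha> \<beta> n s] EndoD(1)[OF \<phi> \<delta>] \<delta> full
        by (simp add: E_def M_def gen_def)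
    qed
    then show "\<phi> = E (\<phi> ?\<delta> id)"
      using Endo_determined_by_gen[OF n, of \<phi> "E (\<phi> ?\<delta> id)"] \<phi> EE unfolding M_def by blast
  qed
  define \<Phi> where "\<Phi> \<phi> = \<phi> ?\<delta> id" for \<phi> :: "(perm \<Rightarrow> 'a) \<Rightarrow> perm \<Rightarrow> 'a"
  have \<Phi>E: "\<Phi> (E x) = x" for x by (simp add: \<Phi>_def E_def \<delta> gen_id)
  have add: "E x + E y = E (x + y)" for x y by (auto simp: E_def fun_eq_iff algebra_simps)
  have comp: "E x \<circ> E y = E (x * y)" for x y using Mc by (auto simp: E_def fun_eq_iff)
  have smult: "smultE c (E x) = E (c * x)" for c x by (auto simp: E_def smultE_def fun_eq_iff)
  have one: "idM M = E 1" by (auto simp: E_def idM_def)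
  have "bij_betw \<Phi> (Endo n M) UNIV"
    by (rule bij_betw_byWitness[where f' = E]) (use EE E_ex \<Phi>E in \<open>auto, metis\<close>)
  then show "End_iso_F n M"
    unfolding End_iso_F_def
    by (intro exI[of _ \<Phi>]) (auto dest!: E_ex simp: add comp smult one \<Phi>E)
  show "indecomposable n M"
  proof (rule indecomposable_if_trivial_idempotents)
    show "M \<noteq> {0}" unfolding M_def by (rule Mmod_nonzero[OF n])
    fix \<phi> assume "\<phi> \<in> Endo n M" and idem: "\<phi> \<circ> \<phi> = \<phi>"
    then obtain x where x: "\<phi> = E x" using E_ex by blast
    then have "x * x = x" using idem comp \<Phi>E by metis
    then have "x = 0 \<or> x = 1" by simp
    moreover have "E 0 = 0" by (auto simp: E_def fun_eq_iff)
    ultimately show "\<phi> = 0 \<or> \<phi> = idM M" using x one by auto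
  qed
qed

section \<open>Two blocks of opposite sign that exhaust the points\<close>

locale young_full_pair = young_pair \<alpha> \<beta> n A B e e'
  for \<alpha> \<beta> n A B and e e' :: "'a :: field" +
  assumes cover: "A \<union> B = {1..n}"
    and A_stab_iff: "s \<in> Sym n \<Longrightarrow> s ` A = A \<Longrightarrow> s \<in> young \<alpha> \<beta> n"
    and opp: "e' = - e" and two: "(2 :: 'a) \<noteq> 0"
    and card_sum: "of_nat (card A) + of_nat (card B) = (0 :: 'a)"
begin

text \<open>The double cosets of the Young subgroup other than those of the identity and of a single
  swap carry no nonzero equivariant function: they are fixed by a swap from the left and from the
  right with opposite signs.\<close>
lemma biequivariant_zero:
  assumes u: "u \<in> M" and right: "\<And>h s. h \<in> H \<Longrightarrow> u (s \<circ> h) = chi \<alpha> h * u s"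
    and u_id: "u id = 0" and xy0: "x0 \<in> A" "y0 \<in> B" and u_swap: "u (transpose x0 y0) = 0"
  shows "u = 0"
proof
  have chi_ne: "chi \<alpha> h \<noteq> (0 :: 'a)" for h using chi_square[of \<alpha> h, where 'a = 'a] by auto
  have vanish: "u (h \<circ> s) = 0" if "u s = 0" "h \<in> H" for h s
    using Mmod_left[OF u that(2)] that(1) by simp
  fix s
  have "u s = 0" if s: "s \<in> Sym n"
  proof (cases "s ` A \<subseteq> A")
    case True
    then have "s ` A = A"
      using fin Sym_inj[OF s] by (metis card_image card_subset_eq inj_on_subset subset_UNIV)
    then show ?thesis using vanish[OF u_id A_stab_iff[OF s]] by simp
  next
    case False
    have sin: "s z \<in> A \<union> B" if "z \<in> A \<union> B" for z
      using permutes_in_image[of s "A \<union> B" z] s that unfolding cover Sym_def by simp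
    obtain x where x: "x \<in> A" "s x \<in> B" using False sin by blast
    show ?thesis
    proof (cases "\<exists>x'\<in>A. x' \<noteq> x \<and> s x' \<in> B")
      case True
      \<comment> \<open>Two points of \<open>A\<close> land in \<open>B\<close>: exchanging them
        gives the sign \<open>e\<close> on the right and \<open>- e\<close> on the left.\<close>
      then obtain x' where x': "x' \<in> A" "x' \<noteq> x" "s x' \<in> B" by blast
      then have ne: "s x \<noteq> s x'" using Sym_eq_iff[OF s] by simp
      have "e * u s = u (s \<circ> transpose x x')"
        using right[OF A_swap[OF x(1) x'(1)]] A_chi[OF x(1) x'(1)] x' by simp
      also have "\<dots> = u (transpose (s x) (s x') \<circ> s)"
        by (simp add: transpose_comp_inj[OF Sym_inj[OF s]])
      also have "\<dots> = - e * u s"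
        using Mmod_left[OF u B_swap[OF x(2) x'(3)]] B_chi[OF x(2) x'(3) ne] opp by simp
      finally have "2 * (e * u s) = 0" by simp
      moreover have "e \<noteq> 0" using e_square by auto
      ultimately show ?thesis using two by simp
    next
      case False
      \<comment> \<open>Otherwise \<open>s\<close> would map \<open>B\<close> onto itself, and
        \<open>s x\<close> would also be the image of a point of \<open>B\<close>.\<close>
      have "\<exists>y\<in>B. s y \<in> A"
      proof (rule ccontr)
        assume "\<not> ?thesis"
        then have "s ` B \<subseteq> B" using sin by blast
        then have "s ` B = B"
          using fin Sym_inj[OF s] by (metis card_image card_subset_eq inj_on_subset subset_UNIV)
        then obtain z where "z \<in> B" "s z = s x" using x by (metis imageE)
        then show False using Sym_eq_iff[OF s] x disj by auto
      qed
      then obtain y where y: "y \<in> B" "s y \<in> A" by blast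
      \<comment> \<open>Transpositions within \<open>A\<close> and \<open>B\<close> move the two
        crossing points to \<open>x0\<close> and \<open>y0\<close>. Then \<open>r\<close> preserves
        \<open>A\<close>, which puts \<open>s'\<close> in the coset of the swap of \<open>x0\<close>
        and \<open>y0\<close>.\<close>
      define s' where "s' = s \<circ> transpose x x0 \<circ> transpose y y0"
      define r where "r = s' \<circ> transpose x0 y0"
      have "r z \<in> A" if z: "z \<in> A" for z
      proof (cases "z = x0")
        case True
        have "y \<noteq> x" "y \<noteq> x0" using disj x xy0 y by auto
        then show ?thesis using True y by (simp add: r_def s'_def)
      next
        case False
        have "z \<noteq> y" "z \<noteq> y0" using disj z xy0 y by auto
        then have "r z = s (transpose x x0 z)" using False by (simp add: r_def s'_def)
        moreover have "transpose x x0 z \<in> A" "transpose x x0 z \<noteq> x"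
          using False z x xy0 by (auto simp: transpose_def)
        ultimately show ?thesis
          using \<open>\<not> (\<exists>x'\<in>A. x' \<noteq> x \<and> s x' \<in> B)\<close> sin by auto
      qed
      moreover have rS: "r \<in> Sym n" unfolding r_def s'_def
        using s x y xy0 A_sub B_sub by (intro Sym_comp transpose_in_Sym) auto
      ultimately have "r ` A = A"
        using fin Sym_inj[OF rS]
        by (metis card_image card_subset_eq image_subsetI inj_on_subset subset_UNIV)
      then have "u (r \<circ> transpose x0 y0) = 0" using vanish[OF u_swap A_stab_iff[OF rS]] by simp
      then have "u s' = 0" by (simp add: r_def comp_assoc)
      then show ?thesis unfolding s'_def
        using right[OF B_swap[OF y(1) xy0(2)]] right[OF A_swap[OF x(1) xy0(1)]] chi_ne by simp
    qed
  qed
  then show "u s = 0 s" using Mmod_outside[OF u] by (cases "s \<in> Sym n") auto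
qed

text \<open>By \<open>biequivariant_zero\<close> an endomorphism is determined by two values of the
  image of the generator, so it is a combination of the identity and an operator \<open>X\<close> of
  square 0. Dual numbers have only trivial idempotents.\<close>

lemma Endo_dual_numbers: "End_iso_dual n M" "indecomposable n M"
proof -
  define a where "a = (of_nat (card A) :: 'a)"
  \<comment> \<open>The two cardinalities have sum 0 in the field, so both roots of \<open>T\<close>
    equal \<open>e * a\<close>; the shift by this double root has square 0.\<close>
  define X where "X f = (\<lambda>s. T f s - e * a * f s)" for f
  define E where "E x y f = (if f \<in> M then (\<lambda>s. x * f s + y * X f s) else 0)" for x y :: 'a and f
  obtain x0 y0 where xy: "x0 \<in> A" "y0 \<in> B" using A_ne B_ne by blast
  note sub = Mmod_submodule[of n \<alpha> \<beta>, where 'a = 'a]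
  have \<delta>: "\<delta> \<in> M" by (rule gen_in_Mmod[OF n_eq])
  have Mc: "0 \<in> M" "\<And>f g. f \<in> M \<Longrightarrow> g \<in> M \<Longrightarrow> f + g \<in> M"
    "\<And>c f. f \<in> M \<Longrightarrow> (\<lambda>s. c * f s) \<in> M" "\<And>g f. g \<in> Sym n \<Longrightarrow> f \<in> M \<Longrightarrow> act g f \<in> M"
    using sub unfolding submodule_def by blast+
  have lin: "(\<lambda>s. x * f s + y * g s) \<in> M" if "f \<in> M" "g \<in> M" for x y f g
    using Mc(2)[OF Mc(3)[OF that(1), of x] Mc(3)[OF that(2), of y]] by (simp add: plus_fun_def)
  have XM: "X f \<in> M" if "f \<in> M" for f
    using lin[OF T_Mmod[OF that] that, of 1 "- (e * a)"] by (simp add: X_def)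
  have Xlin: "X (f + g) = X f + X g" "X (\<lambda>s. c * f s) = (\<lambda>s. c * X f s)" "X (act r f) = act r (X f)"
    for f g c r
    unfolding X_def T_linear by (auto simp: fun_eq_iff act_def algebra_simps)
  have b: "of_nat (card B) = - a" using card_sum unfolding a_def by (simp add: eq_neg_iff_add_eq_0 add.commute)
  have ee: "e * (e * z) = z" for z using e_square by (simp flip: mult.assoc)
  have XX: "X (X f) = 0" if "f \<in> M" for f
  proof
    fix s
    have "T (X f) s = T (T f) s - e * a * T f s"
      unfolding X_def by (simp add: swap_op_def sum_subtractf sum_distrib_left)
    then show "X (X f) s = 0 s"
      unfolding T_square[OF opp two that] b X_def[of "X f"]
      by (simp add: X_def a_def[symmetric] algebra_simps ee)
  qed
  have EE: "E x y \<in> Endo n M" for x y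
    unfolding Endo_def E_def using Mc XM lin
    by (auto simp: Xlin) (auto simp: fun_eq_iff act_def algebra_simps)
  have E\<delta>: "E x y \<delta> id = x - y * (e * a)" "E x y \<delta> (transpose x0 y0) = y" for x y
    using \<delta> xy by (simp_all add: E_def X_def T_gen_at_id T_gen_at_swap gen_at_swap gen_id)
  have E_ex: "\<exists>x y. \<phi> = E x y" if \<phi>: "\<phi> \<in> Endo n M" for \<phi>
  proof (intro exI)
    \<comment> \<open>The coefficients solve the triangular equations
      \<open>E\<delta>\<close>.\<close>
    let ?y = "\<phi> \<delta> (transpose x0 y0)"
    let ?x = "\<phi> \<delta> id + ?y * (e * a)"
    let ?\<psi> = "E ?x ?y"
    have "\<phi> \<delta> - ?\<psi> \<delta> = 0"
    proof (rule biequivariant_zero[OF _ _ _ xy])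
      show "\<phi> \<delta> - ?\<psi> \<delta> \<in> M"
        by (intro submodule_minus[OF sub] EndoD(1)[OF \<phi>] EndoD(1)[OF EE] \<delta>)
      show "(\<phi> \<delta> - ?\<psi> \<delta>) (s \<circ> h) = chi \<alpha> h * (\<phi> \<delta> - ?\<psi> \<delta>) s" if "h \<in> H" for h s
        using Endo_gen_right[OF n_eq \<phi> that, of s] Endo_gen_right[OF n_eq EE that, of ?x ?y s]
        by (simp add: right_diff_distrib)
    qed (simp_all add: E\<delta>)
    then show "\<phi> = ?\<psi>" using Endo_determined_by_gen[OF n_eq \<phi> EE] by simp
  qed
  define \<Phi> where "\<Phi> \<phi> = [:\<phi> \<delta> id + \<phi> \<delta> (transpose x0 y0) * (e * a), \<phi> \<delta> (transpose x0 y0):]" for \<phi>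
  have \<Phi>E: "\<Phi> (E x y) = [:x, y:]" for x y by (simp add: \<Phi>_def E\<delta>)
  have add: "E x y + E x' y' = E (x + x') (y + y')" for x y x' y'
    by (auto simp: E_def fun_eq_iff algebra_simps)
  have comp: "E x y \<circ> E x' y' = E (x * x') (x * y' + y * x')" for x y x' y'
  proof
    fix f
    show "(E x y \<circ> E x' y') f = E (x * x') (x * y' + y * x') f"
    proof (cases "f \<in> M")
      case True
      have "X (\<lambda>s. x' * f s + y' * X f s) = X ((\<lambda>s. x' * f s) + (\<lambda>s. y' * X f s))"
        by (simp add: plus_fun_def)
      also have "\<dots> = (\<lambda>s. x' * X f s)"
        unfolding Xlin XX[OF True] by (auto simp: fun_eq_iff)
      finally show ?thesis using True lin[OF True XM[OF True]]
        by (simp add: E_def fun_eq_iff algebra_simps)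
    next
      case False
      have "X 0 = 0" by (simp add: X_def swap_op_def fun_eq_iff)
      then show ?thesis using False Mc(1) by (auto simp: E_def)
    qed
  qed
  have smult: "smultE c (E x y) = E (c * x) (c * y)" for c x y
    by (auto simp: E_def smultE_def fun_eq_iff algebra_simps)
  have one: "idM M = E 1 0" by (auto simp: E_def idM_def)
  have mult: "\<Phi> (E x y \<circ> E x' y') = (\<Phi> (E x y) * \<Phi> (E x' y')) mod [:0, 0, 1:]" for x y x' y'
    by (simp only: comp \<Phi>E mod_square_linear)
  have "bij_betw \<Phi> (Endo n M) dual_numbers"
  proof (rule bij_betw_byWitness[where f' = "\<lambda>q. E (coeff q 0) (coeff q 1)"])
    show "\<forall>\<phi>\<in>Endo n M. E (coeff (\<Phi> \<phi>) 0) (coeff (\<Phi> \<phi>) 1) = \<phi>"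
      by (auto dest!: E_ex simp: \<Phi>E)
    show "\<forall>q\<in>dual_numbers. \<Phi> (E (coeff q 0) (coeff q 1)) = q"
    proof
      fix q :: "'a poly" assume "q \<in> dual_numbers"
      then have "coeff q k = 0" if "k \<ge> 2" for k
        using that unfolding dual_numbers_def by (auto intro: coeff_eq_0)
      then show "\<Phi> (E (coeff q 0) (coeff q 1)) = q"
        unfolding \<Phi>E by (auto simp: poly_eq_iff coeff_pCons split: nat.split)
    qed
    show "\<Phi> ` Endo n M \<subseteq> dual_numbers" by (auto simp: \<Phi>_def dual_numbers_def)
    show "(\<lambda>q. E (coeff q 0) (coeff q 1)) ` dual_numbers \<subseteq> Endo n M" using EE by auto
  qed
  then show "End_iso_dual n M"
    unfolding End_iso_dual_def
    by (intro exI[of _ \<Phi>], auto dest!: E_ex simp: mult) (simp_all add: add smult one \<Phi>E one_pCons)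
  show "indecomposable n M"
  proof (rule indecomposable_if_trivial_idempotents)
    show "M \<noteq> {0}" by (rule Mmod_nonzero[OF n_eq])
    fix \<phi> assume "\<phi> \<in> Endo n M" and idem: "\<phi> \<circ> \<phi> = \<phi>"
    then obtain x y where x: "\<phi> = E x y" using E_ex by blast
    then have "[:x * x, x * y + y * x:] = [:x, y:]" using idem comp \<Phi>E by metis
    then have x2: "x * x = x" and y2: "x * y + y * x = y" by simp_all
    from x2 have "x = 0 \<or> x = 1" by simp
    \<comment> \<open>For \<open>x = 1\<close> the second equation reads \<open>y + y = y\<close>,
      and for \<open>x = 0\<close> it gives \<open>y = 0\<close> at once.\<close>
    moreover have "y = 0"
    proof (cases "x = 1")
      case True
      then have "y + y = y" using y2 by (simp only: mult_1_left mult_1_right)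
      then show ?thesis using add_cancel_left_right[of y y] by blast
    qed (use y2 calculation in auto)
    moreover have "E 0 0 = 0" by (auto simp: E_def fun_eq_iff)
    ultimately show "\<phi> = 0 \<or> \<phi> = idM M" using x one by auto
  qed
qed

end

section \<open>Two blocks of the same sign: eigenvectors from indicator functions\<close>

context young_pair
begin

definition ind :: "nat \<Rightarrow> 'a" where "ind u = (if u \<in> A then 1 else 0)"

text \<open>The result is affine in \<open>ind u\<close>. The constant cancels in differences, which
  are therefore eigenvectors.\<close>

lemma sum_ind_swap:
  assumes "u \<in> A \<union> B"
  shows "(\<Sum>x\<in>A. \<Sum>y\<in>B. ind (transpose x y u)) = of_nat (card A)
    + (of_nat (card A) * of_nat (card B) - of_nat (card A) - of_nat (card B)) * ind u"
proof (cases "u \<in> A")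
  case True
  have "ind (transpose x y u) = 1 - (if x = u then 1 else 0)" if "x \<in> A" "y \<in> B" for x y
    using that True disj by (auto simp: ind_def transpose_def)
  then have "(\<Sum>x\<in>A. \<Sum>y\<in>B. ind (transpose x y u)) = (\<Sum>x\<in>A. \<Sum>y\<in>B. 1 - (if x = u then 1 else 0))"
    by simp
  also have "\<dots> = of_nat (card A) * of_nat (card B) - of_nat (card B)"
    using True fin by (simp add: sum_subtractf right_diff_distrib left_diff_distrib flip: sum_distrib_left)
  finally show ?thesis using True by (simp add: ind_def)
next
  case False
  have "ind (transpose x y u) = (if y = u then 1 else 0)" if "x \<in> A" "y \<in> B" for x y
    using that False disj by (auto simp: ind_def transpose_def)
  then have "(\<Sum>x\<in>A. \<Sum>y\<in>B. ind (transpose x y u)) = (\<Sum>x\<in>A. \<Sum>y\<in>B. if y = u then 1 else 0)"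
    by simp
  then show ?thesis using assms False fin by (simp add: ind_def)
qed

text \<open>The linear terms cancel in a product of two differences over four distinct points, which
  leaves the quadratic eigenvalue.\<close>

lemma sum_ind_swap2:
  assumes "u \<in> A \<union> B" "v \<in> A \<union> B" "u \<noteq> v"
  shows "(\<Sum>x\<in>A. \<Sum>y\<in>B. ind (transpose x y u) * ind (transpose x y v))
    = (of_nat (card A) - 1) * (ind u + ind v)
    + (of_nat (card A) * of_nat (card B) - 2 * of_nat (card A) - 2 * of_nat (card B) + 2)
      * (ind u * ind v)"
proof -
  \<comment> \<open>The product is 1 exactly when \<open>y = v\<close> and \<open>x\<close> differs
    from \<open>u\<close>.\<close>
  have mixed: "(\<Sum>x\<in>A. \<Sum>y\<in>B. ind (transpose x y u) * ind (transpose x y v)) = of_nat (card A) - 1"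
    if u: "u \<in> A" and v: "v \<in> B" for u v
  proof -
    have "ind (transpose x y u) * ind (transpose x y v)
        = (if y = v then 1 - (if x = u then 1 else 0) else 0)" if "x \<in> A" "y \<in> B" for x y
      using that u v disj by (auto simp: ind_def transpose_def)
    then have "(\<Sum>x\<in>A. \<Sum>y\<in>B. ind (transpose x y u) * ind (transpose x y v))
        = (\<Sum>x\<in>A. \<Sum>y\<in>B. if y = v then 1 - (if x = u then 1 else 0) else 0)"
      by simp
    also have "\<dots> = of_nat (card A) - 1" using u v fin by (simp add: sum_subtractf)
    finally show ?thesis .
  qed
  consider "u \<in> A" "v \<in> A" | "u \<in> A" "v \<in> B" | "u \<in> B" "v \<in> A" | "u \<in> B" "v \<in> B"
    using assms by blast
  then show ?thesis
  proof cases
    case 1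
    have "ind (transpose x y u) * ind (transpose x y v)
        = 1 - (if x = u then 1 else 0) - (if x = v then 1 else 0)" if "x \<in> A" "y \<in> B" for x y
      using that 1 disj \<open>u \<noteq> v\<close> by (auto simp: ind_def transpose_def)
    then have "(\<Sum>x\<in>A. \<Sum>y\<in>B. ind (transpose x y u) * ind (transpose x y v))
        = (\<Sum>x\<in>A. \<Sum>y\<in>B. 1 - (if x = u then 1 else 0) - (if x = v then 1 else 0))"
      by simp
    also have "\<dots> = of_nat (card A) * of_nat (card B) - of_nat (card B) - of_nat (card B)"
      using 1 fin
      by (simp add: sum_subtractf right_diff_distrib left_diff_distrib flip: sum_distrib_left)
    finally show ?thesis using 1 by (simp add: ind_def algebra_simps)
  next
    case 2
    then show ?thesis using mixed[OF 2] disj by (auto simp: ind_def)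
  next
    case 3
    then show ?thesis using mixed[OF 3(2,1)] disj by (auto simp: ind_def mult.commute)
  next
    case 4
    have "ind (transpose x y u) * ind (transpose x y v) = 0" if "x \<in> A" "y \<in> B" for x y
      using that 4 disj \<open>u \<noteq> v\<close> by (auto simp: ind_def transpose_def)
    then have "(\<Sum>x\<in>A. \<Sum>y\<in>B. ind (transpose x y u) * ind (transpose x y v)) = 0"
      by (auto intro!: sum.neutral)
    moreover have "ind u = 0" "ind v = 0" using 4 disj by (auto simp: ind_def)
    ultimately show ?thesis by simp
  qed
qed

text \<open>The eigenvectors are twists by \<open>chi \<alpha>\<close> of polynomials of degree at most two in the indicator
  functions of \<open>A\<close>, supported on the stabiliser of \<open>A \<union> B\<close>.\<close>
lemma not_indecomposable_if_same_sign:
  assumes same: "\<And>x y. x \<in> A \<union> B \<Longrightarrow> y \<in> A \<union> B \<Longrightarrow> x \<noteq> y \<Longrightarrow>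
      chi \<alpha> (transpose x y) = e \<and> transpose x y \<in> side_stab \<alpha> n"
    and char: "CHAR('a) > 2"
    and card: "CHAR('a) dvd card A + card B \<Longrightarrow> card A \<noteq> 1 \<and> card B \<noteq> 1"
  shows "\<not> indecomposable n M"
proof -
  define a b where "a = int (card A)" and "b = int (card B)"
  \<comment> \<open>A set closed under composition that contains the Young subgroup and all swaps
    between \<open>A\<close> and \<open>B\<close>; \<open>chi \<alpha>\<close> is multiplicative on
    it.\<close>
  define L where "L = {s \<in> side_stab \<alpha> n. s ` (A \<union> B) = A \<union> B}"
  define w where "w P s = (if s \<in> L then chi \<alpha> s * P s else 0)" for P :: "perm \<Rightarrow> 'a" and s
  have L_comp: "g \<circ> h \<in> L" if "g \<in> L" "h \<in> L" for g h
    using that side_stab_comp unfolding L_def by (auto simp only: mem_Collect_eq image_comp[symmetric])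
  have HL: "h \<in> L" if "h \<in> H" for h
    using that young_subset_side_stab[OF n_eq] A_stab B_stab unfolding L_def by (auto simp: image_Un)
  have L_Sym: "L \<subseteq> Sym n" unfolding L_def side_stab_def by auto
  have HL_iff: "h \<circ> s \<in> L \<longleftrightarrow> s \<in> L" if "h \<in> H" for h s
  proof
    assume "h \<circ> s \<in> L"
    then have "inv h \<circ> (h \<circ> s) \<in> L" using L_comp HL young_inv that by blast
    moreover have "h \<in> Sym n" using that young_subset_Sym by blast
    ultimately show "s \<in> L" by (simp add: comp_assoc[symmetric] Sym_inv_o)
  qed (use L_comp HL that in blast)
  have tL: "transpose x y \<in> L" if "x \<in> A" "y \<in> B" for x y
    using that same[of x y] disj unfolding L_def by auto
  have tL_iff: "transpose x y \<circ> s \<in> L \<longleftrightarrow> s \<in> L" if "x \<in> A" "y \<in> B" for x y s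
  proof
    assume "transpose x y \<circ> s \<in> L"
    then have "transpose x y \<circ> (transpose x y \<circ> s) \<in> L" using L_comp tL that by blast
    then show "s \<in> L" by (simp add: comp_assoc[symmetric])
  qed (use L_comp tL that in blast)
  have Lchi: "chi \<alpha> (g \<circ> h) = (chi \<alpha> g * chi \<alpha> h :: 'a)" if "g \<in> L" "h \<in> L" for g h
    using that chi_comp unfolding L_def by blast
  have L_id: "id \<in> L" using HL young_id by blast
  have w_M: "w P \<in> M" if "\<And>h s. h \<in> H \<Longrightarrow> P (h \<circ> s) = P s" for P
    unfolding Mmod_def
  proof (intro CollectI conjI allI ballI impI)
    fix h s assume "h \<in> H"
    then show "w P (h \<circ> s) = chi \<alpha> h * w P s"
      using that HL_iff HL Lchi by (simp add: w_def)
  qed (use L_Sym in \<open>auto simp: w_def\<close>)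
  have w_ne: "w P \<noteq> 0" if "P id = 1" for P
  proof
    assume "w P = 0"
    then have "w P id = 0" by simp
    then show False using that L_id chi_id[where 'a = 'a] by (simp add: w_def)
  qed
  \<comment> \<open>Each swap has character \<open>e\<close>, so twisting by the character
    multiplies an eigenvalue by \<open>e\<close>.\<close>
  have w_T: "T (w P) = (\<lambda>s. e * of_int c * w P s)"
    if P: "\<And>s. s \<in> L \<Longrightarrow> (\<Sum>x\<in>A. \<Sum>y\<in>B. P (transpose x y \<circ> s)) = of_int c * P s" for P c
  proof
    fix s
    show "T (w P) s = e * of_int c * w P s"
    proof (cases "s \<in> L")
      case True
      have "w P (transpose x y \<circ> s) = e * chi \<alpha> s * P (transpose x y \<circ> s)" if "x \<in> A" "y \<in> B" for x y
      proof -
        have "x \<noteq> y" using that disj by auto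
        then show ?thesis
          using that True same[of x y] tL[OF that] by (simp add: w_def tL_iff Lchi)
      qed
      then have "T (w P) s = e * chi \<alpha> s * (\<Sum>x\<in>A. \<Sum>y\<in>B. P (transpose x y \<circ> s))"
        by (simp add: swap_op_def sum_distrib_left)
      then show ?thesis using P[OF True] True by (simp add: w_def mult_ac)
    qed (simp add: swap_op_def w_def tL_iff)
  qed
  have e: "e = 1 \<or> e = - 1" using e_square by (simp add: square_eq_1_iff)
  have two_eigenvalues: "\<not> indecomposable n M"
    if P: "\<And>h s. h \<in> H \<Longrightarrow> P (h \<circ> s) = P s" "P id = 1"
        "\<And>s. s \<in> L \<Longrightarrow> (\<Sum>x\<in>A. \<Sum>y\<in>B. P (transpose x y \<circ> s)) = of_int c * P s"
      and Q: "\<And>h s. h \<in> H \<Longrightarrow> Q (h \<circ> s) = Q s" "Q id = 1"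
        "\<And>s. s \<in> L \<Longrightarrow> (\<Sum>x\<in>A. \<Sum>y\<in>B. Q (transpose x y \<circ> s)) = of_int d * Q s"
      and cd: "of_int c \<noteq> (of_int d :: 'a)" for P Q :: "perm \<Rightarrow> 'a" and c d
  proof -
    define l :: int where "l = (if e = 1 then c else - c)"
    have l: "of_int l = e * of_int c" using e by (auto simp: l_def)
    show ?thesis
    proof (rule not_indecomposable_if_two_eigenvalues[OF Mmod_submodule, where I = "A \<times> B"
        and t = "\<lambda>(x, y). transpose x y" and T = T and l = l and m = "e * of_int d"
        and v = "w P" and w = "w Q"])
      show "T (w P) = (\<lambda>s. of_int l * w P s)" unfolding l by (rule w_T[OF P(3)])
      show "T (w Q) = (\<lambda>s. e * of_int d * w Q s)" by (rule w_T[OF Q(3)])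
      show "of_int l \<noteq> e * of_int d" unfolding l using cd e by auto
      show "T f s = (\<Sum>i\<in>A \<times> B. f ((case i of (x, y) \<Rightarrow> transpose x y) \<circ> s))" for f s
        by (simp add: swap_op_def sum.cartesian_product case_prod_beta)
    qed (use char fin swap_Sym w_M[of P, OF P(1)] w_ne[of P, OF P(2)]
        w_M[of Q, OF Q(1)] w_ne[of Q, OF Q(2)] T_Mmod in auto)
  qed
  have indH: "ind (h u) = ind u" if "h \<in> H" for h u
  proof -
    have "inj h" using that young_subset_Sym Sym_inj by blast
    then have "h u \<in> A \<longleftrightarrow> u \<in> A" using A_stab[OF that] by (metis inj_image_mem_iff)
    then show ?thesis by (simp add: ind_def)
  qed
  obtain k l where kl: "k \<in> A" "l \<in> B" using A_ne B_ne by blast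
  have Lin: "s u \<in> A \<union> B" if "s \<in> L" "u \<in> A \<union> B" for s u
    using that unfolding L_def by blast
  have Lne: "s u \<noteq> s v" if "s \<in> L" "u \<noteq> v" for s u v
    using that L_Sym Sym_eq_iff by blast
  have lin: "(\<Sum>x\<in>A. \<Sum>y\<in>B. ind (transpose x y (s u)) - ind (transpose x y (s v)))
      = of_int (a * b - a - b) * (ind (s u) - ind (s v))"
    if "s \<in> L" "u \<in> A \<union> B" "v \<in> A \<union> B" for s u v
    unfolding sum_subtractf sum_ind_swap[OF Lin[OF that(1,2)]] sum_ind_swap[OF Lin[OF that(1,3)]]
    by (simp add: a_def b_def algebra_simps)
  have id_kl: "ind k = 1" "ind l = 0" if "k \<in> A" "l \<in> B" for k l
    using that disj by (auto simp: ind_def)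
  show ?thesis
  proof (cases "CHAR('a) dvd card A + card B")
    case False
    \<comment> \<open>The constant and the linear eigenvalue differ by \<open>a + b\<close>.\<close>
    have "(of_int (a * b) :: 'a) - of_int (a * b - a - b) = of_nat (card A + card B)"
      by (simp add: a_def b_def)
    also have "\<dots> \<noteq> 0" using False of_nat_eq_0_iff_char_dvd by blast
    finally have ne: "of_int (a * b) \<noteq> (of_int (a * b - a - b) :: 'a)"
      by (simp only: right_minus_eq not_False_eq_True)
    show ?thesis
      by (rule two_eigenvalues[where P = "\<lambda>s. 1" and Q = "\<lambda>s. ind (s k) - ind (s l)", OF _ _ _ _ _ _ ne])
        (use kl in \<open>simp_all add: indH lin id_kl a_def b_def\<close>)
  next
    case True
    have "0 < card A" "0 < card B" using A_ne B_ne fin by (simp_all add: card_gt_0_iff)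
    then have "2 \<le> card A" "2 \<le> card B" using card[OF True] by linarith+
    then obtain k' l' where k': "k' \<in> A" "k' \<noteq> k" and l': "l' \<in> B" "l' \<noteq> l"
      using fin by (metis card_2_iff' card_le_Suc0_iff_eq not_less_eq_eq numeral_2_eq_2)
    have ne4: "k \<noteq> l'" "k' \<noteq> l" "l \<noteq> k'" using kl k' l' disj by auto
    \<comment> \<open>The quadratic eigenvector needs a second point in each set, which is why
      neither may be a singleton.\<close>
    let ?Q = "\<lambda>s. (ind (s k) - ind (s l)) * (ind (s k') - ind (s l'))"
    have quad: "(\<Sum>x\<in>A. \<Sum>y\<in>B. ind (transpose x y (s u)) * ind (transpose x y (s v)))
      = (of_int a - 1) * (ind (s u) + ind (s v))
      + of_int (a * b - 2 * a - 2 * b + 2) * (ind (s u) * ind (s v))"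
      if "s \<in> L" "u \<in> A \<union> B" "v \<in> A \<union> B" "u \<noteq> v" for s u v
      using sum_ind_swap2[OF Lin[OF that(1,2)] Lin[OF that(1,3)] Lne[OF that(1,4)]]
      by (simp add: a_def b_def)
    have Q: "(\<Sum>x\<in>A. \<Sum>y\<in>B. ?Q (transpose x y \<circ> s)) = of_int (a * b - 2 * a - 2 * b + 2) * ?Q s"
      if s: "s \<in> L" for s
    proof -
      have "(\<Sum>x\<in>A. \<Sum>y\<in>B. ?Q (transpose x y \<circ> s))
        = (\<Sum>x\<in>A. \<Sum>y\<in>B. ind (transpose x y (s k)) * ind (transpose x y (s k')))
        - (\<Sum>x\<in>A. \<Sum>y\<in>B. ind (transpose x y (s k)) * ind (transpose x y (s l')))
        - (\<Sum>x\<in>A. \<Sum>y\<in>B. ind (transpose x y (s l)) * ind (transpose x y (s k')))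
        + (\<Sum>x\<in>A. \<Sum>y\<in>B. ind (transpose x y (s l)) * ind (transpose x y (s l')))"
        unfolding sum_subtractf[symmetric] sum.distrib[symmetric]
        by (intro sum.cong refl) (simp add: algebra_simps)
      also have "\<dots> = of_int (a * b - 2 * a - 2 * b + 2) * ?Q s"
        using kl k' l' ne4
        by (subst (1 2 3 4) quad) (auto simp: s algebra_simps simp del: of_int_add of_int_diff of_int_mult)
      finally show ?thesis .
    qed
    have "of_int (a + b) = (of_nat (card A + card B) :: 'a)" by (simp add: a_def b_def)
    also have "\<dots> = 0" using True of_nat_eq_0_iff_char_dvd by blast
    finally have ab: "of_int (a + b) = (0 :: 'a)" .
    have two: "(2 :: 'a) \<noteq> 0"
      using of_nat_eq_0_iff_char_dvd[of 2, where 'a = 'a] char by (auto dest: dvd_imp_le)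
    \<comment> \<open>When \<open>a + b\<close> vanishes in the field, the quadratic and the linear
      eigenvalue differ by 2.\<close>
    have "(of_int (a * b - 2 * a - 2 * b + 2) :: 'a) - of_int (a * b - a - b) = 2 - of_int (a + b)"
      by simp
    also have "\<dots> \<noteq> 0" using two unfolding ab by simp
    finally have ne: "of_int (a * b - a - b) \<noteq> (of_int (a * b - 2 * a - 2 * b + 2) :: 'a)"
      unfolding right_minus_eq by (rule not_sym)
    show ?thesis
      by (rule two_eigenvalues[where P = "\<lambda>s. ind (s k) - ind (s l)" and Q = ?Q, OF _ _ _ _ _ Q ne])
        (use kl k' l' in \<open>simp_all add: indH lin id_kl\<close>)
  qed
qed

end

section \<open>Parts of a pair of partitions as pairs of blocks\<close>

lemma P2_sum_pos:
  assumes "(\<alpha>, \<beta>) \<in> P2 n"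
  shows "sum_list \<alpha> + sum_list \<beta> = n" "\<And>i. i < length (\<alpha> @ \<beta>) \<Longrightarrow> 0 < (\<alpha> @ \<beta>) ! i"
proof -
  show "sum_list \<alpha> + sum_list \<beta> = n" using assms by (simp add: P2_def)
  have "\<forall>x\<in>set (\<alpha> @ \<beta>). 0 < x" using assms by (auto simp: P2_def is_partition_def)
  then show "0 < (\<alpha> @ \<beta>) ! i" if "i < length (\<alpha> @ \<beta>)" for i using that nth_mem by blast
qed

definition block_sign :: "nat list \<Rightarrow> nat \<Rightarrow> 'a :: field" where
  "block_sign \<alpha> i = (if i < length \<alpha> then 1 else - 1)"

lemma block_chi:
  assumes "x \<in> block (\<alpha> @ \<beta>) i" "y \<in> block (\<alpha> @ \<beta>) j" "x \<noteq> y"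
    and "i < length \<alpha> \<longleftrightarrow> j < length \<alpha>"
  shows "chi \<alpha> (transpose x y) = (block_sign \<alpha> i :: 'a :: field)"
proof -
  have "sum_list \<alpha> < x \<longleftrightarrow> \<not> i < length \<alpha>" "sum_list \<alpha> < y \<longleftrightarrow> \<not> j < length \<alpha>"
    using block_above_iff[OF assms(1)] block_above_iff[OF assms(2)] by auto
  then show ?thesis using chi_transpose[of \<alpha> x y, where 'a = 'a] assms by (simp add: block_sign_def)
qed

text \<open>A block with a single element contains no proper transposition, so either sign may be
  attributed to it; this is how \<open>(kp - 1, 1)\<close> is covered by the case of opposite signs.\<close>
lemma young_pair_blocks:
  fixes e e' :: "'a :: field"
  assumes P2: "(\<alpha>, \<beta>) \<in> P2 n" and ij: "i < length (\<alpha> @ \<beta>)" "j < length (\<alpha> @ \<beta>)" "i \<noteq> j"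
    and e: "e = block_sign \<alpha> i"
    and e': "(\<alpha> @ \<beta>) ! j \<noteq> 1 \<Longrightarrow> e' = block_sign \<alpha> j"
  shows "young_pair \<alpha> \<beta> n (block (\<alpha> @ \<beta>) i) (block (\<alpha> @ \<beta>) j) e e'"
proof
  note n = P2_sum_pos(1)[OF P2]
  show "sum_list \<alpha> + sum_list \<beta> = n" by (rule n)
  show "block (\<alpha> @ \<beta>) i \<subseteq> {1..n}" "block (\<alpha> @ \<beta>) j \<subseteq> {1..n}"
    using block_subset[of "\<alpha> @ \<beta>"] n by simp_all
  show "block (\<alpha> @ \<beta>) i \<inter> block (\<alpha> @ \<beta>) j = {}" using ij by (intro block_disjoint)
  have "card (block (\<alpha> @ \<beta>) i) > 0" "card (block (\<alpha> @ \<beta>) j) > 0"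
    using P2_sum_pos(2)[OF P2] ij by (simp_all add: card_block)
  then show "block (\<alpha> @ \<beta>) i \<noteq> {}" "block (\<alpha> @ \<beta>) j \<noteq> {}" by auto
  show "h ` block (\<alpha> @ \<beta>) i = block (\<alpha> @ \<beta>) i" "h ` block (\<alpha> @ \<beta>) j = block (\<alpha> @ \<beta>) j"
    if "h \<in> young \<alpha> \<beta> n" for h
    using young_block[OF that] ij by blast+
  show "transpose x y \<in> young \<alpha> \<beta> n" if "x \<in> block (\<alpha> @ \<beta>) i" "y \<in> block (\<alpha> @ \<beta>) i" for x y
    by (rule transpose_in_young[OF n that])
  show "transpose x y \<in> young \<alpha> \<beta> n" if "x \<in> block (\<alpha> @ \<beta>) j" "y \<in> block (\<alpha> @ \<beta>) j" for x y
    by (rule transpose_in_young[OF n that])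
  show "chi \<alpha> (transpose x y) = e"
    if "x \<in> block (\<alpha> @ \<beta>) i" "y \<in> block (\<alpha> @ \<beta>) i" "x \<noteq> y" for x y
    using block_chi[OF that] e by simp
  show "chi \<alpha> (transpose x y) = e'"
    if xy: "x \<in> block (\<alpha> @ \<beta>) j" "y \<in> block (\<alpha> @ \<beta>) j" "x \<noteq> y" for x y
  proof -
    have "card (block (\<alpha> @ \<beta>) j) \<noteq> 1" using xy by (auto simp: card_1_singleton_iff)
    then show ?thesis using block_chi[OF xy] e' ij by (simp add: card_block)
  qed
  show "e * e = 1" using e by (simp add: block_sign_def)
qed

text \<open>Collects the contrapositives of \<open>not_indecomposable_if_same_sign\<close> and
  \<open>not_indecomposable_if_opposite\<close>.\<close>

lemma indecomposable_blocks:
  assumes P2: "(\<alpha>, \<beta>) \<in> P2 n" and ij: "i < length (\<alpha> @ \<beta>)" "j < length (\<alpha> @ \<beta>)" "i \<noteq> j"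
    and char: "CHAR('a :: field) > 2" and ind: "indecomposable n (Mmod \<alpha> \<beta> n :: (perm \<Rightarrow> 'a) set)"
  shows "CHAR('a) dvd (\<alpha> @ \<beta>) ! i + (\<alpha> @ \<beta>) ! j"
    "(i < length \<alpha> \<longleftrightarrow> j < length \<alpha>) \<Longrightarrow> (\<alpha> @ \<beta>) ! i = 1 \<or> (\<alpha> @ \<beta>) ! j = 1"
proof -
  let ?A = "block (\<alpha> @ \<beta>) i" and ?B = "block (\<alpha> @ \<beta>) j" and ?e = "block_sign \<alpha> i :: 'a"
  have "CHAR('a) dvd (\<alpha> @ \<beta>) ! i + (\<alpha> @ \<beta>) ! j \<and>
    ((i < length \<alpha> \<longleftrightarrow> j < length \<alpha>) \<longrightarrow> (\<alpha> @ \<beta>) ! i = 1 \<or> (\<alpha> @ \<beta>) ! j = 1)"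
  proof (cases "i < length \<alpha> \<longleftrightarrow> j < length \<alpha>")
    case True
    interpret young_pair \<alpha> \<beta> n ?A ?B ?e ?e
      by (rule young_pair_blocks[OF P2 ij refl]) (use True in \<open>simp add: block_sign_def\<close>)
    have same: "chi \<alpha> (transpose x y) = ?e \<and> transpose x y \<in> side_stab \<alpha> n"
      if xy: "x \<in> ?A \<union> ?B" "y \<in> ?A \<union> ?B" "x \<noteq> y" for x y
    proof -
      obtain i' j' where ij': "i' \<in> {i, j}" "j' \<in> {i, j}" "x \<in> block (\<alpha> @ \<beta>) i'" "y \<in> block (\<alpha> @ \<beta>) j'"
        using xy by blast
      then have "i' < length \<alpha> \<longleftrightarrow> j' < length \<alpha>" "(block_sign \<alpha> i' :: 'a) = ?e"
        using True by (auto simp: block_sign_def)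
      then have "chi \<alpha> (transpose x y) = ?e" "sum_list \<alpha> < x \<longleftrightarrow> sum_list \<alpha> < y"
        using block_chi[OF ij'(3,4) xy(3), where 'a = 'a] block_above_iff ij' by (metis, metis not_less)
      then show ?thesis using transpose_in_side_stab[of \<alpha> x y n] xy A_sub B_sub by blast
    qed
    then show ?thesis using not_indecomposable_if_same_sign[OF same char] ind ij
      by (auto simp: card_block)
  next
    case False
    interpret young_pair \<alpha> \<beta> n ?A ?B ?e "- ?e"
      by (rule young_pair_blocks[OF P2 ij refl]) (use False in \<open>auto simp: block_sign_def\<close>)
    show ?thesis using not_indecomposable_if_opposite[OF refl char] ind ij False
      by (auto simp: card_block)
  qed
  then show "CHAR('a) dvd (\<alpha> @ \<beta>) ! i + (\<alpha> @ \<beta>) ! j"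
    "(i < length \<alpha> \<longleftrightarrow> j < length \<alpha>) \<Longrightarrow> (\<alpha> @ \<beta>) ! i = 1 \<or> (\<alpha> @ \<beta>) ! j = 1" by auto
qed

lemma indecomposable_at_most_two_blocks:
  assumes P2: "(\<alpha>, \<beta>) \<in> P2 n" and char: "odd CHAR('a :: field)" "CHAR('a) > 2"
    and ind: "indecomposable n (Mmod \<alpha> \<beta> n :: (perm \<Rightarrow> 'a) set)"
  shows "length (\<alpha> @ \<beta>) \<le> 2"
proof (rule ccontr)
  assume "\<not> ?thesis"
  then have len: "i < length (\<alpha> @ \<beta>)" if "i < 3" for i using that by linarith
  let ?p = "CHAR('a)" and ?c = "\<lambda>i. (\<alpha> @ \<beta>) ! i"
  have dvd: "?p dvd ?c i + ?c j" if "i < 3" "j < 3" "i \<noteq> j" for i j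
    using indecomposable_blocks(1)[OF P2 len[OF that(1)] len[OF that(2)] that(3) char(2) ind] .
  \<comment> \<open>Two pair sums minus the third leave twice one part, and the characteristic is
    odd.\<close>
  have all: "?p dvd ?c i" if ijk: "i < 3" "j < 3" "k < 3" "i \<noteq> j" "i \<noteq> k" "j \<noteq> k" for i j k
  proof -
    have "?p dvd (?c i + ?c j) + (?c i + ?c k)"
      by (rule dvd_add[OF dvd[OF ijk(1,2,4)] dvd[OF ijk(1,3,5)]])
    then have "?p dvd 2 * ?c i + (?c j + ?c k)" by (simp only: mult_2 ac_simps)
    then have "?p dvd 2 * ?c i" using dvd[of j k] ijk by (simp add: dvd_add_left_iff)
    moreover have "coprime ?p 2" using char(1) by simp
    ultimately show ?thesis by (simp add: coprime_dvd_mult_right_iff)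
  qed
  have "?p dvd ?c 0" "?p dvd ?c 1" "?p dvd ?c 2"
    using all[of 0 1 2] all[of 1 0 2] all[of 2 0 1] by auto
  then have ne1: "?c i \<noteq> 1" if "i < 3" for i
    using that char(2) by (auto simp: less_Suc_eq numeral_3_eq_3 numeral_2_eq_2)
  have contra: False if ij: "i < 3" "j < 3" "i \<noteq> j" "i < length \<alpha> \<longleftrightarrow> j < length \<alpha>" for i j
    using indecomposable_blocks(2)[OF P2 len[OF ij(1)] len[OF ij(2)] ij(3) char(2) ind ij(4)]
      ne1[OF ij(1)] ne1[OF ij(2)] by blast
  \<comment> \<open>Of three blocks two lie in the same partition.\<close>
  show False using contra[of 0 1] contra[of 0 2] contra[of 1 2] by auto
qed

text \<open>If \<open>length \<alpha> = 1\<close> the two blocks have opposite signs; if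
  \<open>b = 1\<close> the sign of the second block is free and is chosen opposite.\<close>

lemma two_blocks_dual:
  assumes P2: "(\<alpha>, \<beta>) \<in> P2 n" and two: "\<alpha> @ \<beta> = [a, b]" and char: "CHAR('a :: field) > 2"
    and dvd: "CHAR('a) dvd a + b" and sgn: "b = 1 \<or> length \<alpha> = 1"
  defines "M \<equiv> Mmod \<alpha> \<beta> n :: (perm \<Rightarrow> 'a) set"
  shows "End_iso_dual n M" "indecomposable n M"
proof -
  let ?A = "block (\<alpha> @ \<beta>) 0" and ?B = "block (\<alpha> @ \<beta>) 1" and ?e = "block_sign \<alpha> 0 :: 'a"
  have n: "n = a + b" using P2_sum_pos(1)[OF P2] two 
    by (metis sum_list_append sum_list.Cons sum_list.Nil add_0_right)
  have A: "?A = {1..a}" and B: "?B = {a<..a + b}" unfolding two block_def by auto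
  interpret young_pair \<alpha> \<beta> n ?A ?B ?e "- ?e"
    by (rule young_pair_blocks[OF P2 _ _ _ refl]) (use sgn in \<open>auto simp: two block_sign_def\<close>)
  interpret young_full_pair \<alpha> \<beta> n ?A ?B ?e "- ?e"
  proof
    show "?A \<union> ?B = {1..n}" unfolding A B n by auto
    show "s \<in> young \<alpha> \<beta> n" if s: "s \<in> Sym n" "s ` ?A = ?A" for s
    proof -
      have "s ` {1..n} = {1..n}" using s unfolding Sym_def by (auto simp only: mem_Collect_eq permutes_image)
      \<comment> \<open>A permutation of \<open>{1..n}\<close> that preserves \<open>?A\<close>
        preserves its complement as well.\<close>
      moreover have "?B = {1..n} - ?A" unfolding A B n by auto
      ultimately have "s ` ?B = ?B" using s Sym_inj[OF s(1)] by (metis image_set_diff)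
      then show ?thesis using s unfolding young_def two by (auto simp: less_Suc_eq)
    qed
    show "(2 :: 'a) \<noteq> 0"
      using of_nat_eq_0_iff_char_dvd[of 2, where 'a = 'a] char by (auto dest: dvd_imp_le)
    have "of_nat (a + b) = (0 :: 'a)" using dvd of_nat_eq_0_iff_char_dvd by blast
    then show "of_nat (card ?A) + of_nat (card ?B) = (0 :: 'a)" unfolding A B by simp
  qed simp
  show "End_iso_dual n M" "indecomposable n M" unfolding M_def by (rule Endo_dual_numbers)+
qed

text \<open>The only block is all of \<open>{1..n}\<close>; for \<open>n = 0\<close> there is no
  block at all.\<close>

lemma young_one_block:
  assumes "\<alpha> @ \<beta> = row n"
  shows "young \<alpha> \<beta> n = Sym n"
proof -
  have "s ` {0<..n} = {0<..n}" if "s \<in> Sym n" for s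
  proof -
    have "{0<..n} = {1..n}" by auto
    then show ?thesis using that unfolding Sym_def by (simp only: mem_Collect_eq permutes_image)
  qed
  then show ?thesis unfolding young_def assms by (auto simp: row_def block_def)
qed

section \<open>The classification and the endomorphism rings\<close>

theorem theorem1p4:
  fixes p n :: nat and \<alpha> \<beta> :: "nat list"
  assumes "prime p" and "odd p" and "CHAR('a::field) = p"
    and "(\<alpha>, \<beta>) \<in> P2 n"
  defines "M \<equiv> (Mmod \<alpha> \<beta> n :: (perm \<Rightarrow> 'a) set)"
  shows "(indecomposable n M \<longleftrightarrow>
           (\<exists>m n'. m + n' = n \<and> \<alpha> = row m \<and> \<beta> = row n' \<and> (m = 0 \<or> n' = 0 \<or> p dvd (m + n'))) \<or>
           (\<exists>k\<ge>1. (\<alpha>, \<beta>) = ([k * p - 1, 1], []) \<or> (\<alpha>, \<beta>) = ([], [k * p - 1, 1])))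
     \<and> ((\<exists>m n'. m + n' = n \<and> \<alpha> = row m \<and> \<beta> = row n' \<and> (m = 0 \<or> n' = 0)) \<longrightarrow> End_iso_F n M)
     \<and> (((\<exists>m n'. m + n' = n \<and> \<alpha> = row m \<and> \<beta> = row n' \<and> m \<noteq> 0 \<and> n' \<noteq> 0 \<and> p dvd (m + n')) \<or>
          (\<exists>k\<ge>1. (\<alpha>, \<beta>) = ([k * p - 1, 1], []) \<or> (\<alpha>, \<beta>) = ([], [k * p - 1, 1])))
        \<longrightarrow> End_iso_dual n M)"
proof -
  have "2 \<le> p" using assms(1) by (rule prime_ge_2_nat)
  then have p: "2 < p" using assms(2) by (cases "p = 2") auto
  then have char: "CHAR('a) > 2" "odd CHAR('a)" using assms(2,3) by auto
  note n = P2_sum_pos(1)[OF assms(4)]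
  have one: "End_iso_F n M \<and> indecomposable n M"
    if "m + n' = n" "\<alpha> = row m" "\<beta> = row n'" "m = 0 \<or> n' = 0" for m n'
  proof -
    have "\<alpha> @ \<beta> = row n" using that by (auto simp: row_def)
    then show ?thesis using full_young_Endo[OF n young_one_block] unfolding M_def by blast
  qed
  have mixed: "End_iso_dual n M \<and> indecomposable n M"
    if "m + n' = n" "\<alpha> = row m" "\<beta> = row n'" "m \<noteq> 0" "n' \<noteq> 0" "p dvd m + n'" for m n'
  proof -
    have "\<alpha> @ \<beta> = [m, n']" "length \<alpha> = 1" using that by (auto simp: row_def)
    then show ?thesis
      using two_blocks_dual[OF assms(4) _ char(1), of m n'] that(6) assms(3) unfolding M_def by blast
  qed
  have hook: "End_iso_dual n M \<and> indecomposable n M"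
    if "1 \<le> k" "(\<alpha>, \<beta>) = ([k * p - 1, 1], []) \<or> (\<alpha>, \<beta>) = ([], [k * p - 1, 1])" for k
  proof -
    \<comment> \<open>Positivity makes the truncated subtraction in \<open>k * p - 1\<close>
      exact.\<close>
    have "0 < k * p" using that(1) p by simp
    then have "p dvd (k * p - 1) + 1" by simp
    moreover have "\<alpha> @ \<beta> = [k * p - 1, 1]" using that(2) by auto
    ultimately show ?thesis
      using two_blocks_dual[OF assms(4) _ char(1), of "k * p - 1" 1] assms(3) unfolding M_def by blast
  qed
  have hookI: "\<exists>k\<ge>1. x = k * p - 1 \<and> y = 1"
    if dvd: "p dvd x + y" and "x = 1 \<or> y = 1" "y \<le> x" "0 < y" for x y
  proof -
    \<comment> \<open>If the larger part is 1, so is the smaller one.\<close>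
    have y: "y = 1" using that(2-4) by auto
    then obtain k where k: "x + 1 = p * k" using dvd by (auto elim: dvdE)
    then have "1 \<le> k" "x = k * p - 1" by (cases k, auto simp: mult.commute)
    then show ?thesis using y by blast
  qed
  have only: "(\<exists>m n'. m + n' = n \<and> \<alpha> = row m \<and> \<beta> = row n' \<and> (m = 0 \<or> n' = 0 \<or> p dvd (m + n'))) \<or>
      (\<exists>k\<ge>1. (\<alpha>, \<beta>) = ([k * p - 1, 1], []) \<or> (\<alpha>, \<beta>) = ([], [k * p - 1, 1]))"
    if ind: "indecomposable n M"
  proof -
    have len: "length \<alpha> + length \<beta> \<le> 2"
      using indecomposable_at_most_two_blocks[OF assms(4) char(2,1)] ind unfolding M_def by simp
    have pair: "p dvd (\<alpha> @ \<beta>) ! 0 + (\<alpha> @ \<beta>) ! 1"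
      "(0 < length \<alpha> \<longleftrightarrow> 1 < length \<alpha>) \<Longrightarrow> (\<alpha> @ \<beta>) ! 0 = 1 \<or> (\<alpha> @ \<beta>) ! 1 = 1"
      if "length \<alpha> + length \<beta> = 2"
      using indecomposable_blocks[OF assms(4) _ _ _ char(1), of 0 1] ind that assms(3)
      unfolding M_def by simp_all
    have part: "is_partition \<alpha>" "is_partition \<beta>" using assms(4) by (auto simp: P2_def)
    have "length \<alpha> \<le> 1 \<and> length \<beta> \<le> 1 \<or> length \<alpha> = 2 \<and> \<beta> = []
        \<or> \<alpha> = [] \<and> length \<beta> = 2"
      using len unfolding length_0_conv[symmetric] by linarith
    then consider "length \<alpha> \<le> 1 \<and> length \<beta> \<le> 1" | "length \<alpha> = 2" "\<beta> = []" | "\<alpha> = []" "length \<beta> = 2"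
      by blast
    then show ?thesis
    proof cases
      case 1
      \<comment> \<open>Parts are positive, so the list \<open>[0]\<close>, which is not a
        \<open>row\<close>, cannot occur.\<close>
      have row: "c = row (sum_list c)" if "length c \<le> 1" "is_partition c" for c
        using that by (cases c) (auto simp: row_def is_partition_def)
      have "sum_list \<alpha> = 0 \<or> sum_list \<beta> = 0 \<or> p dvd sum_list \<alpha> + sum_list \<beta>"
      proof (cases "length \<alpha> + length \<beta> = 2")
        case True
        then obtain x y where "\<alpha> = [x]" "\<beta> = [y]"
          using 1 by (cases \<alpha>; cases \<beta>) auto
        then show ?thesis using pair(1)[OF True] by simp
      next
        case False
        then have "\<alpha> = [] \<or> \<beta> = []" using 1 by (cases \<alpha>; cases \<beta>) auto
        then show ?thesis by auto
      qed
      then show ?thesis using row[of \<alpha>] row[of \<beta>] 1 part n by blast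
    next
      case 2
      then obtain x y where xy: "\<alpha> = [x, y]" by (auto simp: length_Suc_conv numeral_2_eq_2)
      then have "y \<le> x" "0 < y" using part(1) by (auto simp: is_partition_def)
      then show ?thesis using hookI[of x y] pair 2 xy by auto
    next
      case 3
      then obtain x y where xy: "\<beta> = [x, y]" by (auto simp: length_Suc_conv numeral_2_eq_2)
      then have "y \<le> x" "0 < y" using part(2) by (auto simp: is_partition_def)
      then show ?thesis using hookI[of x y] pair 3 xy by auto
    qed
  qed
  show ?thesis
  proof (intro conjI iffI impI)
    assume "(\<exists>m n'. m + n' = n \<and> \<alpha> = row m \<and> \<beta> = row n' \<and> (m = 0 \<or> n' = 0 \<or> p dvd (m + n'))) \<or>
      (\<exists>k\<ge>1. (\<alpha>, \<beta>) = ([k * p - 1, 1], []) \<or> (\<alpha>, \<beta>) = ([], [k * p - 1, 1]))"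
    then show "indecomposable n M" using one mixed hook by metis
  next
    assume "\<exists>m n'. m + n' = n \<and> \<alpha> = row m \<and> \<beta> = row n' \<and> (m = 0 \<or> n' = 0)"
    then show "End_iso_F n M" using one by blast
  next
    assume "(\<exists>m n'. m + n' = n \<and> \<alpha> = row m \<and> \<beta> = row n' \<and> m \<noteq> 0 \<and> n' \<noteq> 0 \<and> p dvd (m + n')) \<or>
      (\<exists>k\<ge>1. (\<alpha>, \<beta>) = ([k * p - 1, 1], []) \<or> (\<alpha>, \<beta>) = ([], [k * p - 1, 1]))"
    then show "End_iso_dual n M" using mixed hook by metis
  qed (rule only)
qed

end
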